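(* Fix $\lambda>0$. Suppose that the parameters $\mathsf{a},c_1,c_2$ vary with $N$ in one of the following ways: (a) $c_1=c_1(N)=\sqrt{N/\lambda}$, $\mathsf{a}=\sqrt{\lambda/(N+1)}$, and $c_2$ is fixed; (b) $c_1$ is fixed, $\mathsf{a}=1/N^{\theta+1}$, $c_2=c_2(N)=\lambda N^\theta$ for some fixed $\theta>0$. For each (sufficiently large) $N$ let $(\mathbf{L}_1,\mathbf{L}_2)$ have the law $\mathbb{P}^{(\mathsf{a},c_1,c_2)}_{\rm Geo}$ with these parameters. Then, as $N\to\infty$, the process $(\mathbf{L}_1(\lfloor Nx\rfloor))_{0\le x\le1}$ converges in finite-dimensional distributions to the Poisson process $(\mathbf{N}_x)_{0\le x\le1}$ with parameter $\lambda$.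
   Context: For $N\ge1$ and $(m_1,\dots,m_N),(n_1,\dots,n_N)\in\mathbb{Z}_{\ge0}^N$ let $\mathbf{L}_1(j)=\sum_{k=1}^j m_k$ and $\mathbf{L}_2(j)=\sum_{k=1}^j n_k$ for $1\le j\le N$, with $\mathbf{L}_1(0)=\mathbf{L}_2(0)=0$. For $\mathsf{a}\in(0,1)$ and $c_1,c_2>0$ with $\mathsf{a}c_1,\mathsf{a}c_2<1$ define the weight $$\mathbb{Q}_N^{(\mathsf{a},c_1,c_2)}(\mathbf{L}_1,\mathbf{L}_2)=\mathsf{a}^{\mathbf{L}_1(N)}\mathsf{a}^{\mathbf{L}_2(N)}(c_1c_2)^{\max_{1\le j\le N}(\mathbf{L}_2(j)-\mathbf{L}_1(j-1))}\,c_2^{\mathbf{L}_1(N)-\mathbf{L}_2(N)} .$$ Its sum over all pairs, $\mathcal{Z}^{(\mathsf{a},c_1,c_2)}(N)$, is finite, and $\mathbb{P}^{(\mathsf{a},c_1,c_2)}_{\rm Geo}=\mathbb{Q}_N^{(\mathsf{a},c_1,c_2)}/\mathcal{Z}^{(\mathsf{a},c_1,c_2)}(N)$ is the resulting probability measure. (The marginal law of $\mathbf{L}_1$ is the stationary measure of geometric last passage percolation on a strip of width $N+1$ with bulk parameter $\mathsf{a}$ and boundary parameters $c_1,c_2$.) Boundary parameters are positive throughout; in cases (a), (b) the conditions $\mathsf{a}<1$, $\mathsf{a}c_1<1$, $\mathsf{a}c_2<1$ hold for all large $N$. *)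

theory Defs
  imports "HOL-Probability.Probability"
begin

section \<open>The geometric two-path measure\<close>

text \<open>A sample point is the pair \<open>(m, n)\<close> of step sequences indexed by \<open>{1..N}\<close>; the paths
  \<open>\<^bold>L\<^sub>1\<close>, \<open>\<^bold>L\<^sub>2\<close> are their partial sums.\<close>

definition partial_sum :: "(nat \<Rightarrow> nat) \<Rightarrow> nat \<Rightarrow> nat" where
  "partial_sum m j = (\<Sum>k=1..j. m k)"

definition step_pairs :: "nat \<Rightarrow> ((nat \<Rightarrow> nat) \<times> (nat \<Rightarrow> nat)) set" where
  "step_pairs N = ({1..N} \<rightarrow>\<^sub>E UNIV) \<times> ({1..N} \<rightarrow>\<^sub>E UNIV)"

definition weight ::
  "nat \<Rightarrow> real \<Rightarrow> real \<Rightarrow> real \<Rightarrow> (nat \<Rightarrow> nat) \<Rightarrow> (nat \<Rightarrow> nat) \<Rightarrow> real" where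
  "weight N a c1 c2 L1 L2 =
     a ^ L1 N * a ^ L2 N
     * (c1 * c2) powi (MAX j\<in>{1..N}. int (L2 j) - int (L1 (j - 1)))
     * c2 powi (int (L1 N) - int (L2 N))"

definition partition_fun :: "nat \<Rightarrow> real \<Rightarrow> real \<Rightarrow> real \<Rightarrow> real" where
  "partition_fun N a c1 c2 =
     (\<Sum>\<^sub>\<infinity>(m, n)\<in>step_pairs N. weight N a c1 c2 (partial_sum m) (partial_sum n))"

text \<open>This is a probability measure when \<open>N \<ge> 1\<close>, \<open>0 < a < 1\<close>, \<open>c1, c2 > 0\<close> and
  \<open>a * c1, a * c2 < 1\<close>; outside this range it carries no meaning.\<close>

definition P_Geo ::
  "nat \<Rightarrow> real \<Rightarrow> real \<Rightarrow> real \<Rightarrow> ((nat \<Rightarrow> nat) \<times> (nat \<Rightarrow> nat)) measure" where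
  "P_Geo N a c1 c2 =
     point_measure (step_pairs N)
       (\<lambda>(m, n). ennreal (weight N a c1 c2 (partial_sum m) (partial_sum n) / partition_fun N a c1 c2))"

section \<open>Poisson processes\<close>

text \<open>Since the paths are almost surely nondecreasing on \<open>T\<close>, the truncated subtraction of natural
  numbers is almost surely the true increment.\<close>

locale poisson_process = prob_space M for M :: "'w measure" +
  fixes T :: "real set" and rate :: real and X :: "real \<Rightarrow> 'w \<Rightarrow> nat"
  assumes measurable_process: "\<And>t. t \<in> T \<Longrightarrow> X t \<in> measurable M (count_space UNIV)"
    and starts_at_zero: "AE \<omega> in M. X 0 \<omega> = 0"
    and nondecreasing: "AE \<omega> in M. mono_on T (\<lambda>t. X t \<omega>)"
    and right_continuous:
      "AE \<omega> in M. \<forall>t\<in>T. continuous (at t within T \<inter> {t..}) (\<lambda>s. X s \<omega>)"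
    and poisson_increments:
      "\<And>s t. \<lbrakk>s \<in> T; t \<in> T; s < t\<rbrakk> \<Longrightarrow>
         distr M (count_space UNIV) (\<lambda>\<omega>. X t \<omega> - X s \<omega>) = measure_pmf (poisson_pmf (rate * (t - s)))"
    and independent_increments:
      "\<And>(t :: nat \<Rightarrow> real) n. \<lbrakk>t ` {..n} \<subseteq> T; strict_mono_on {..n} t\<rbrakk> \<Longrightarrow>
         indep_vars (\<lambda>_. count_space UNIV) (\<lambda>i \<omega>. X (t (Suc i)) \<omega> - X (t i) \<omega>) {..<n}"

section \<open>Convergence of finite-dimensional distributions\<close>

text \<open>For each finite set \<open>J\<close> of times, the laws of \<open>(X\<^sub>N(t))\<^sub>t\<^sub>\<in>\<^sub>J\<close> on \<open>\<real>\<^sup>J\<close> converge weakly to the law of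
  \<open>(Y(t))\<^sub>t\<^sub>\<in>\<^sub>J\<close>, that is, when tested against bounded continuous functions.\<close>

definition fdd_converges ::
  "(nat \<Rightarrow> 'a measure) \<Rightarrow> (nat \<Rightarrow> 't \<Rightarrow> 'a \<Rightarrow> real) \<Rightarrow>
   'b measure \<Rightarrow> ('t \<Rightarrow> 'b \<Rightarrow> real) \<Rightarrow> 't set \<Rightarrow> bool" where
  "fdd_converges P X Q Y T \<longleftrightarrow>
     (\<forall>J f. finite J \<longrightarrow> J \<subseteq> T \<longrightarrow>
        continuous_map (product_topology (\<lambda>_. euclideanreal) J) euclideanreal f \<longrightarrow>
        bounded (f ` (J \<rightarrow>\<^sub>E UNIV)) \<longrightarrow>
        (\<lambda>N. \<integral>\<omega>. f (\<lambda>t\<in>J. X N t \<omega>) \<partial>P N) \<longlonglongrightarrow> (\<integral>\<omega>. f (\<lambda>t\<in>J. Y t \<omega>) \<partial>Q))"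

end

theory Submission
  imports Defs "HOL-Real_Asymp.Real_Asymp"
begin

text \<open>Each index \<open>j\<close> attaining the maximum in the weight gives a product of geometric weights:
  \<open>a / c1\<close> for \<open>m\<close> before \<open>j\<close> and \<open>a * c2\<close> from \<open>j\<close> on, \<open>a * c1\<close> for \<open>n\<close> up to \<open>j\<close> and \<open>a / c2\<close> after
  \<open>j\<close>. In case (a) the index \<open>j = N\<close> carries asymptotically all the mass, so the steps of the first
  path become independent geometric variables with parameter \<open>a / c1 \<approx> \<lambda> / N\<close>. In case (b) the
  second path is asymptotically null, and the steps of the first one become geometric with
  parameter \<open>a * c2 = \<lambda> / N\<close>. Both times the normalised partition function tends to \<open>exp \<lambda>\<close>.
  Counting step sequences with values in \<open>{0, 1}\<close> then bounds the point masses of the increments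
  from below by products of Poisson probabilities, up to vanishing errors; as these limits already
  have total mass 1, the laws of the increments converge.\<close>

section \<open>Sums of geometric products over step sequences\<close>

text \<open>The sum factors over the coordinates. This first yields only the value of
  \<open>infsum\<close>; summability is then read off from that value being non-zero.\<close>

lemma has_sum_prod_geometric:
  fixes p :: "'i \<Rightarrow> real"
  assumes "finite A" and p: "\<And>j. j \<in> A \<Longrightarrow> 0 \<le> p j \<and> p j < 1"
  shows "((\<lambda>m. \<Prod>j\<in>A. p j ^ m j) has_sum (\<Prod>j\<in>A. 1 / (1 - p j))) (A \<rightarrow>\<^sub>E UNIV)"
proof -
  have geo: "((\<lambda>k. p j ^ k) has_sum 1 / (1 - p j)) UNIV" if "j \<in> A" for j
    using p[OF that] geometric_sums[of "p j"] by (intro sums_nonneg_imp_has_sum) auto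
  have "infsum (\<lambda>m. \<Prod>j\<in>A. p j ^ m j) (A \<rightarrow>\<^sub>E UNIV) = (\<Prod>j\<in>A. infsum (\<lambda>k. p j ^ k) UNIV)"
    using geo p \<open>finite A\<close> by (intro infsum_prod_PiE_abs) (auto intro: has_sum_imp_summable)
  also have "\<dots> = (\<Prod>j\<in>A. 1 / (1 - p j))"
    using geo by (intro prod.cong) (auto intro: infsumI)
  finally have eq: "infsum (\<lambda>m. \<Prod>j\<in>A. p j ^ m j) (A \<rightarrow>\<^sub>E UNIV) = (\<Prod>j\<in>A. 1 / (1 - p j))" .
  \<comment> \<open>\<open>infsum\<close> is 0 on families that are not summable\<close>
  moreover have "(\<Prod>j\<in>A. 1 / (1 - p j)) \<noteq> 0"
    using \<open>finite A\<close> p by fastforce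
  ultimately have "(\<lambda>m. \<Prod>j\<in>A. p j ^ m j) summable_on (A \<rightarrow>\<^sub>E UNIV)"
    using infsum_not_exists by metis
  then show ?thesis
    using eq by (simp add: has_sum_iff)
qed

lemma has_sum_times_nonneg:
  fixes f :: "'a \<Rightarrow> real" and g :: "'b \<Rightarrow> real"
  assumes f: "(f has_sum s) A" "\<And>x. x \<in> A \<Longrightarrow> f x \<ge> 0"
    and g: "(g has_sum t) B" "\<And>y. y \<in> B \<Longrightarrow> g y \<ge> 0"
  shows "((\<lambda>(x, y). f x * g y) has_sum s * t) (A \<times> B)"
proof (rule has_sum_SigmaI)
  show "((\<lambda>y. case (x, y) of (x, y) \<Rightarrow> f x * g y) has_sum f x * t) B" for x
    using has_sum_cmult_right[OF g(1)] by simp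
  show "((\<lambda>x. f x * t) has_sum s * t) A"
    using has_sum_cmult_left[OF f(1)] .
  show "(\<lambda>(x, y). f x * g y) summable_on A \<times> B"
  proof (rule summable_on_SigmaI)
    show "((\<lambda>y. case (x, y) of (x, y) \<Rightarrow> f x * g y) has_sum f x * t) B" for x
      using has_sum_cmult_right[OF g(1)] by simp
    show "(\<lambda>x. f x * t) summable_on A"
      using has_sum_cmult_left[OF f(1)] by (rule has_sum_imp_summable)
  qed (use f g in auto)
qed

lemma partial_sum_mono: "i \<le> j \<Longrightarrow> partial_sum m i \<le> partial_sum m j"
  unfolding partial_sum_def by (intro sum_mono2) auto

lemma partial_sum_diff:
  assumes "i \<le> j"
  shows "partial_sum m j = partial_sum m i + (\<Sum>k\<in>{i<..j}. m k)"
proof -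
  have "{1..j} = {1..i} \<union> {i<..j}"
    using assms by auto
  then show ?thesis
    unfolding partial_sum_def by (subst sum.union_disjoint[symmetric]) auto
qed

lemma prod_power_split:
  fixes u v :: real
  assumes "k \<le> N"
  shows "(\<Prod>j\<in>{1..N}. (if j \<le> k then u else v) ^ m j)
    = u ^ partial_sum m k * v ^ (partial_sum m N - partial_sum m k)"
proof -
  have "{1..N} = {1..k} \<union> {k<..N}"
    using assms by auto
  then have "(\<Prod>j\<in>{1..N}. (if j \<le> k then u else v) ^ m j)
      = (\<Prod>j\<in>{1..k}. (if j \<le> k then u else v) ^ m j) * (\<Prod>j\<in>{k<..N}. (if j \<le> k then u else v) ^ m j)"
    by (simp only:, subst prod.union_disjoint) auto
  also have "\<dots> = (\<Prod>j\<in>{1..k}. u ^ m j) * (\<Prod>j\<in>{k<..N}. v ^ m j)"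
    by (intro arg_cong2[where f = "(*)"] prod.cong) auto
  also have "\<dots> = u ^ partial_sum m k * v ^ (partial_sum m N - partial_sum m k)"
    using partial_sum_diff[OF assms, of m] by (simp add: power_sum partial_sum_def)
  finally show ?thesis .
qed

lemma prod_const_split:
  fixes x y :: real
  assumes "k \<le> N"
  shows "(\<Prod>j\<in>{1..N}. 1 / (1 - (if j \<le> k then x else y))) = (1 / (1 - x)) ^ k * (1 / (1 - y)) ^ (N - k)"
proof -
  have "{1..N} = {1..k} \<union> {k<..N}"
    using assms by auto
  then have "(\<Prod>j\<in>{1..N}. 1 / (1 - (if j \<le> k then x else y)))
      = (\<Prod>j\<in>{1..k}. 1 / (1 - (if j \<le> k then x else y))) * (\<Prod>j\<in>{k<..N}. 1 / (1 - (if j \<le> k then x else y)))"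
    by (simp only:, subst prod.union_disjoint) auto
  also have "\<dots> = (\<Prod>j\<in>{1..k}. 1 / (1 - x)) * (\<Prod>j\<in>{k<..N}. 1 / (1 - y))"
    by (intro arg_cong2[where f = "(*)"] prod.cong) auto
  finally show ?thesis
    by simp
qed

text \<open>This is the normalisation of two independent families of geometric steps, each changing
  its parameter once: after \<open>k\<close> for \<open>m\<close>, after \<open>l\<close> for
  \<open>n\<close>. Every candidate term of the maximum in the weight has this shape.\<close>

lemma has_sum_geometric_split:
  fixes x y u v :: real
  assumes "k \<le> N" "l \<le> N" and "0 \<le> x" "x < 1" "0 \<le> y" "y < 1" "0 \<le> u" "u < 1" "0 \<le> v" "v < 1"
  shows "((\<lambda>(m, n). x ^ partial_sum m k * y ^ (partial_sum m N - partial_sum m k)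
            * (u ^ partial_sum n l * v ^ (partial_sum n N - partial_sum n l)))
          has_sum ((1 / (1 - x)) ^ k * (1 / (1 - y)) ^ (N - k)
            * ((1 / (1 - u)) ^ l * (1 / (1 - v)) ^ (N - l)))) (step_pairs N)"
proof -
  have *: "((\<lambda>m. x ^ partial_sum m k * y ^ (partial_sum m N - partial_sum m k))
      has_sum ((1 / (1 - x)) ^ k * (1 / (1 - y)) ^ (N - k))) ({1..N} \<rightarrow>\<^sub>E UNIV)"
    if "k \<le> N" "0 \<le> x" "x < 1" "0 \<le> y" "y < 1" for k and x y :: real
    using has_sum_prod_geometric[of "{1..N}" "\<lambda>j. if j \<le> k then x else y"] that
    unfolding prod_power_split[OF \<open>k \<le> N\<close>] prod_const_split[OF \<open>k \<le> N\<close>] by simp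
  show ?thesis
    unfolding step_pairs_def using assms
    by (intro has_sum_times_nonneg *) auto
qed

section \<open>Comparing the weight with the candidate terms of its maximum\<close>

text \<open>Freezing the index \<open>j\<close> in the maximum makes the expression multiplicative
  in the steps of both paths, which the weight itself in general is not.\<close>

definition max_term ::
  "nat \<Rightarrow> real \<Rightarrow> real \<Rightarrow> real \<Rightarrow> nat \<Rightarrow> (nat \<Rightarrow> nat) \<Rightarrow> (nat \<Rightarrow> nat) \<Rightarrow> real" where
  "max_term N a c1 c2 j L1 L2 =
     a ^ L1 N * a ^ L2 N * (c1 * c2) powi (int (L2 j) - int (L1 (j - 1)))
     * c2 powi (int (L1 N) - int (L2 N))"

text \<open>Each unit of a step of \<open>m\<close> carries \<open>a * c2\<close>, divided by
  \<open>c1 * c2\<close> if it is counted in \<open>L1 (j - 1)\<close>; each unit of a step of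
  \<open>n\<close> carries \<open>a / c2\<close>, multiplied by \<open>c1 * c2\<close> if it is
  counted in \<open>L2 j\<close>. Hence the first path splits one site earlier than the
  second.\<close>

lemma max_term_eq:
  assumes "a > 0" "c1 > 0" "c2 > 0" "j \<le> N"
  shows "max_term N a c1 c2 j (partial_sum m) (partial_sum n) =
    (a / c1) ^ partial_sum m (j - 1) * (a * c2) ^ (partial_sum m N - partial_sum m (j - 1))
    * ((a * c1) ^ partial_sum n j * (a / c2) ^ (partial_sum n N - partial_sum n j))"
proof -
  \<comment> \<open>Additive remainders replace the truncated subtractions in the exponents.\<close>
  obtain e where e: "partial_sum m N = partial_sum m (j - 1) + e"
    using partial_sum_mono[of "j - 1" N m] assms(4) by (metis diff_le_self le_trans le_Suc_ex)
  obtain e' where e': "partial_sum n N = partial_sum n j + e'"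
    using partial_sum_mono[of j N n] assms(4) by (metis le_Suc_ex)
  show ?thesis
    unfolding max_term_def e e' using assms
    by (simp add: power_int_diff power_int_add power_add power_mult_distrib power_divide field_simps)
qed

lemma max_term_nonneg: "a \<ge> 0 \<Longrightarrow> c1 \<ge> 0 \<Longrightarrow> c2 \<ge> 0 \<Longrightarrow> max_term N a c1 c2 j L1 L2 \<ge> 0"
  unfolding max_term_def by simp

lemma weight_eq_max_term:
  assumes "N \<ge> 1"
  shows "\<exists>j\<in>{1..N}. weight N a c1 c2 L1 L2 = max_term N a c1 c2 j L1 L2"
proof -
  have "(MAX j\<in>{1..N}. int (L2 j) - int (L1 (j - 1))) \<in> (\<lambda>j. int (L2 j) - int (L1 (j - 1))) ` {1..N}"
    using assms by (intro Max_in) auto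
  then obtain j where "j \<in> {1..N}" "(MAX j\<in>{1..N}. int (L2 j) - int (L1 (j - 1))) = int (L2 j) - int (L1 (j - 1))"
    by auto
  then show ?thesis
    unfolding weight_def max_term_def by metis
qed

lemma weight_nonneg: "a \<ge> 0 \<Longrightarrow> c1 \<ge> 0 \<Longrightarrow> c2 \<ge> 0 \<Longrightarrow> weight N a c1 c2 L1 L2 \<ge> 0"
  unfolding weight_def by simp

lemma weight_le_sum_max_term:
  assumes "N \<ge> 1" "a \<ge> 0" "c1 \<ge> 0" "c2 \<ge> 0"
  shows "weight N a c1 c2 L1 L2 \<le> (\<Sum>j=1..N. max_term N a c1 c2 j L1 L2)"
proof -
  obtain j where "j \<in> {1..N}" "weight N a c1 c2 L1 L2 = max_term N a c1 c2 j L1 L2"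
    using weight_eq_max_term[OF assms(1)] by blast
  then show ?thesis
    using assms member_le_sum[of j "{1..N}" "\<lambda>j. max_term N a c1 c2 j L1 L2"]
    by (auto simp: max_term_nonneg)
qed

text \<open>For a base \<open>c1 * c2\<close> of at least 1 the power grows with its exponent, so
  the weight dominates the term of every index, not only that of a maximising one.\<close>

lemma max_term_le_weight:
  assumes "j \<in> {1..N}" "a > 0" "c2 > 0" "c1 * c2 \<ge> 1"
  shows "max_term N a c1 c2 j L1 L2 \<le> weight N a c1 c2 L1 L2"
  unfolding weight_def max_term_def using assms
  by (intro mult_right_mono mult_left_mono power_int_increasing Max_ge) auto

text \<open>The maximum is at most \<open>L2 N\<close>, and putting this exponent in its place
  decouples the two paths. This bound is sharp enough when \<open>a * c1\<close> is of smaller order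
  than \<open>1 / N\<close>, as in case (b).\<close>

lemma weight_le_powers:
  assumes "N \<ge> 1" "a > 0" "c1 > 0" "c2 > 0" "c1 * c2 \<ge> 1"
  shows "weight N a c1 c2 (partial_sum m) (partial_sum n)
    \<le> (a * c2) ^ partial_sum m N * (a * c1) ^ partial_sum n N"
proof -
  obtain j where j: "j \<in> {1..N}"
    "weight N a c1 c2 (partial_sum m) (partial_sum n) = max_term N a c1 c2 j (partial_sum m) (partial_sum n)"
    using weight_eq_max_term[OF assms(1)] by blast
  have "max_term N a c1 c2 j (partial_sum m) (partial_sum n)
      \<le> a ^ partial_sum m N * a ^ partial_sum n N * (c1 * c2) powi int (partial_sum n N)
        * c2 powi (int (partial_sum m N) - int (partial_sum n N))"
    unfolding max_term_def using assms j partial_sum_mono[of j N n]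
    by (intro mult_right_mono mult_left_mono power_int_increasing) auto
  also have "\<dots> = (a * c2) ^ partial_sum m N * (a * c1) ^ partial_sum n N"
    using assms by (simp add: power_int_diff field_simps)
  finally show ?thesis
    using j by simp
qed

section \<open>Point measures, and convergence of integrals from bounds on point masses\<close>

lemma emeasure_point_measure_infsum:
  fixes f :: "'a \<Rightarrow> real"
  assumes f: "f summable_on S" "\<And>x. x \<in> S \<Longrightarrow> f x \<ge> 0" and "A \<subseteq> S"
  shows "emeasure (point_measure S (\<lambda>x. ennreal (f x))) A = ennreal (infsum f A)"
proof -
  have sumA: "f summable_on A"
    using f(1) \<open>A \<subseteq> S\<close> by (rule summable_on_subset_banach)
  then have "(\<lambda>x. norm (f x)) summable_on A"
    using f(2) \<open>A \<subseteq> S\<close> by (subst summable_on_cong[of _ _ f]) auto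
  \<comment> \<open>Integrals against \<open>count_space\<close> are expressed through
    \<open>infsetsum\<close>, so summability is transferred to that notion first.\<close>
  then have abs: "Infinite_Set_Sum.abs_summable_on f A"
    unfolding abs_summable_equivalent .
  have "emeasure (point_measure S (\<lambda>x. ennreal (f x))) A
      = (\<integral>\<^sup>+x. ennreal (f x) * indicator A x \<partial>count_space S)"
    unfolding point_measure_def using \<open>A \<subseteq> S\<close> by (subst emeasure_density) auto
  also have "\<dots> = (\<integral>\<^sup>+x. ennreal (f x) \<partial>count_space A)"
    using \<open>A \<subseteq> S\<close> by (auto simp: nn_integral_count_space_indicator intro!: nn_integral_cong split: split_indicator)
  also have "\<dots> = ennreal (infsum f A)"
    using abs f(2) \<open>A \<subseteq> S\<close> by (subst nn_integral_conv_infsetsum) (auto simp: infsetsum_infsum)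
  finally show ?thesis .
qed

text \<open>The finite sum is the integral of \<open>H (V \<omega>)\<close> over the event that
  \<open>V\<close> lands in \<open>F\<close>; leaving out the complement can only decrease the
  integral since \<open>H\<close> is non-negative.\<close>

lemma (in prob_space) sum_prob_le_integral:
  fixes H :: "'c \<Rightarrow> real"
  assumes V: "V \<in> measurable M (count_space UNIV)"
    and H: "\<And>v. 0 \<le> H v" "\<And>v. H v \<le> B" and "finite F"
  shows "(\<Sum>v\<in>F. H v * prob (V -` {v} \<inter> space M)) = (\<integral>\<omega>. H (V \<omega>) * indicator F (V \<omega>) \<partial>M)"
    and "(\<Sum>v\<in>F. H v * prob (V -` {v} \<inter> space M)) \<le> (\<integral>\<omega>. H (V \<omega>) \<partial>M)"
proof -
  have meas: "V -` A \<inter> space M \<in> sets M" for A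
    using V by (rule measurable_sets) simp
  have HV: "(\<lambda>\<omega>. H (V \<omega>)) \<in> borel_measurable M"
    using V by (rule measurable_compose) simp
  have FV: "(\<lambda>\<omega>. indicator F (V \<omega>) :: real) \<in> borel_measurable M"
    using V by (rule measurable_compose) simp
  have int: "integrable M (\<lambda>\<omega>. H (V \<omega>))"
    using HV H by (intro integrable_const_bound[where B = B]) auto
  have "(\<Sum>v\<in>F. H v * prob (V -` {v} \<inter> space M))
      = (\<Sum>v\<in>F. \<integral>\<omega>. H v * indicator (V -` {v} \<inter> space M) \<omega> \<partial>M)"
    using meas by (intro sum.cong) auto
  also have "\<dots> = (\<integral>\<omega>. (\<Sum>v\<in>F. H v * indicator (V -` {v} \<inter> space M) \<omega>) \<partial>M)"
    using meas by (intro Bochner_Integration.integral_sum[symmetric] integrable_mult_right)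
      (auto simp: emeasure_eq_measure intro!: integrable_real_indicator)
  also have "\<dots> = (\<integral>\<omega>. H (V \<omega>) * indicator F (V \<omega>) \<partial>M)"
  proof (intro Bochner_Integration.integral_cong refl)
    fix \<omega> assume "\<omega> \<in> space M"
    then have "(\<Sum>v\<in>F. H v * indicator (V -` {v} \<inter> space M) \<omega>) = (\<Sum>v\<in>F. if V \<omega> = v then H v else 0)"
      by (intro sum.cong) (auto simp: indicator_def)
    then show "(\<Sum>v\<in>F. H v * indicator (V -` {v} \<inter> space M) \<omega>) = H (V \<omega>) * indicator F (V \<omega>)"
      using \<open>finite F\<close> by simp
  qed
  finally show eq: "(\<Sum>v\<in>F. H v * prob (V -` {v} \<inter> space M)) = (\<integral>\<omega>. H (V \<omega>) * indicator F (V \<omega>) \<partial>M)" .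
  show "(\<Sum>v\<in>F. H v * prob (V -` {v} \<inter> space M)) \<le> (\<integral>\<omega>. H (V \<omega>) \<partial>M)"
    unfolding eq
  proof (rule integral_mono)
    show "integrable M (\<lambda>\<omega>. H (V \<omega>) * indicator F (V \<omega>))"
      using HV FV H order_trans[OF H(1) H(2)]
      by (intro integrable_const_bound[where B = B]) (auto simp: indicator_def)
    show "H (V \<omega>) * indicator F (V \<omega>) \<le> H (V \<omega>)" for \<omega>
      using H by (simp add: indicator_def)
  qed (use int in auto)
qed

text \<open>A countable type is exhausted by the finite sets of elements with code at most
  \<open>k\<close>, and dominated convergence recovers the whole integral along them.\<close>

lemma (in prob_space) integral_approx_finite_sum:
  fixes V :: "'a \<Rightarrow> 'c :: countable" and H :: "'c \<Rightarrow> real"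
  assumes V: "V \<in> measurable M (count_space UNIV)"
    and H: "\<And>v. 0 \<le> H v" "\<And>v. H v \<le> B" and "\<epsilon> > 0"
  obtains F where "finite F" "(\<integral>\<omega>. H (V \<omega>) \<partial>M) - \<epsilon> < (\<Sum>v\<in>F. H v * prob (V -` {v} \<inter> space M))"
proof -
  define F where "F k = {v :: 'c. to_nat v \<le> k}" for k
  have fin: "finite (F k)" for k
    unfolding F_def by (rule finite_imageD[of to_nat]) (auto intro: finite_subset[of _ "{..k}"] inj_on_subset[OF inj_to_nat])
  have "(\<lambda>k. \<integral>\<omega>. H (V \<omega>) * indicator (F k) (V \<omega>) \<partial>M) \<longlonglongrightarrow> (\<integral>\<omega>. H (V \<omega>) \<partial>M)"
  proof (rule integral_dominated_convergence[where w = "\<lambda>_. B"])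
    show "(\<lambda>\<omega>. H (V \<omega>)) \<in> borel_measurable M"
      using V by (rule measurable_compose) simp
    show "(\<lambda>\<omega>. H (V \<omega>) * indicator (F k) (V \<omega>)) \<in> borel_measurable M" for k
      by (rule measurable_compose[OF V, of "\<lambda>v. H v * indicator (F k) v"]) simp
    show "AE \<omega> in M. norm (H (V \<omega>) * indicator (F k) (V \<omega>)) \<le> B" for k
      using H order_trans[OF H(1) H(2)] by (auto simp: indicator_def)
    have "(\<lambda>k. H v * indicator (F k) v) \<longlonglongrightarrow> H v" for v
      by (rule tendsto_eventually) (auto simp: F_def eventually_sequentially indicator_def intro!: exI[of _ "to_nat v"])
    then show "AE \<omega> in M. (\<lambda>k. H (V \<omega>) * indicator (F k) (V \<omega>)) \<longlonglongrightarrow> H (V \<omega>)"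
      by simp
  qed simp
  then have "eventually (\<lambda>k. (\<integral>\<omega>. H (V \<omega>) \<partial>M) - \<epsilon> < (\<integral>\<omega>. H (V \<omega>) * indicator (F k) (V \<omega>) \<partial>M)) sequentially"
    using \<open>\<epsilon> > 0\<close> by (intro order_tendstoD(1)) auto
  then obtain k where "(\<integral>\<omega>. H (V \<omega>) \<partial>M) - \<epsilon> < (\<integral>\<omega>. H (V \<omega>) * indicator (F k) (V \<omega>) \<partial>M)"
    by (auto simp: eventually_sequentially)
  then show thesis
    using that[OF fin[of k]] sum_prob_le_integral(1)[OF V H fin[of k]] by simp
qed

text \<open>No upper bound on the point masses is needed, since mass cannot escape: the limits
  already add up to 1.\<close>

lemma integral_tendsto_of_point_mass_bound:
  fixes P :: "nat \<Rightarrow> 'a measure" and Q :: "'b measure"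
    and V :: "nat \<Rightarrow> 'a \<Rightarrow> 'c :: countable" and W :: "'b \<Rightarrow> 'c" and H :: "'c \<Rightarrow> real"
  assumes P: "eventually (\<lambda>N. prob_space (P N)) sequentially"
    and V: "\<And>N. V N \<in> measurable (P N) (count_space UNIV)"
    and Q: "prob_space Q" and W: "W \<in> measurable Q (count_space UNIV)"
    and H: "\<And>v. \<bar>H v\<bar> \<le> B"
    and g_lim: "\<And>v. g v \<longlonglongrightarrow> measure Q (W -` {v} \<inter> space Q)"
    and g_le: "\<And>v. eventually (\<lambda>N. g v N \<le> measure (P N) (V N -` {v} \<inter> space (P N))) sequentially"
  shows "(\<lambda>N. \<integral>\<omega>. H (V N \<omega>) \<partial>P N) \<longlonglongrightarrow> (\<integral>\<omega>. H (W \<omega>) \<partial>Q)"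
proof -
  interpret Q: prob_space Q by fact
  \<comment> \<open>A Fatou-type bound: finitely many values capture the integral under
    \<open>Q\<close> up to \<open>\<epsilon>\<close>, and on these the lower bounds \<open>g\<close>
    converge to the masses under \<open>Q\<close>.\<close>
  have lower: "eventually (\<lambda>N. (\<integral>\<omega>. h (W \<omega>) \<partial>Q) - \<epsilon> < (\<integral>\<omega>. h (V N \<omega>) \<partial>P N)) sequentially"
    if h: "\<And>v. 0 \<le> h v" "\<And>v. h v \<le> C" and "\<epsilon> > 0" for h :: "'c \<Rightarrow> real" and C \<epsilon>
  proof -
    obtain F where F: "finite F"
      "(\<integral>\<omega>. h (W \<omega>) \<partial>Q) - \<epsilon> < (\<Sum>v\<in>F. h v * measure Q (W -` {v} \<inter> space Q))"
      using Q.integral_approx_finite_sum[OF W h \<open>\<epsilon> > 0\<close>] .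
    have "(\<lambda>N. \<Sum>v\<in>F. h v * g v N) \<longlonglongrightarrow> (\<Sum>v\<in>F. h v * measure Q (W -` {v} \<inter> space Q))"
      by (intro tendsto_intros g_lim)
    then have "eventually (\<lambda>N. (\<integral>\<omega>. h (W \<omega>) \<partial>Q) - \<epsilon> < (\<Sum>v\<in>F. h v * g v N)) sequentially"
      using F(2) by (rule order_tendstoD(1))
    moreover have "eventually (\<lambda>N. \<forall>v\<in>F. g v N \<le> measure (P N) (V N -` {v} \<inter> space (P N))) sequentially"
      using F(1) g_le by (simp add: eventually_ball_finite)
    ultimately show ?thesis
      using P
    proof eventually_elim
      case (elim N)
      then interpret prob_space "P N" by simp
      have "(\<Sum>v\<in>F. h v * g v N) \<le> (\<Sum>v\<in>F. h v * measure (P N) (V N -` {v} \<inter> space (P N)))"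
        using elim h by (intro sum_mono mult_left_mono) auto
      also have "\<dots> \<le> (\<integral>\<omega>. h (V N \<omega>) \<partial>P N)"
        using sum_prob_le_integral(2)[OF V h F(1)] .
      finally show ?case
        using elim by linarith
    qed
  qed
  have shift: "(\<integral>\<omega>. B + H (U \<omega>) \<partial>R) = B + (\<integral>\<omega>. H (U \<omega>) \<partial>R)"
      "(\<integral>\<omega>. B - H (U \<omega>) \<partial>R) = B - (\<integral>\<omega>. H (U \<omega>) \<partial>R)"
    if "prob_space R" "U \<in> measurable R (count_space UNIV)" for R :: "'d measure" and U
  proof -
    interpret R: prob_space R by fact
    have "integrable R (\<lambda>\<omega>. H (U \<omega>))"
      using measurable_compose[OF that(2), of H borel] H
      by (intro R.integrable_const_bound[where B = B]) auto
    then show "(\<integral>\<omega>. B + H (U \<omega>) \<partial>R) = B + (\<integral>\<omega>. H (U \<omega>) \<partial>R)"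
        "(\<integral>\<omega>. B - H (U \<omega>) \<partial>R) = B - (\<integral>\<omega>. H (U \<omega>) \<partial>R)"
      by (simp_all add: R.prob_space)
  qed
  show ?thesis
  proof (rule tendstoI)
    fix \<epsilon> :: real assume "\<epsilon> > 0"
    \<comment> \<open>Both \<open>B + H\<close> and \<open>B - H\<close> are non-negative, so the
      one-sided bound applied to each of them gives the two halves of the limit.\<close>
    have "0 \<le> B + H v" "B + H v \<le> 2 * B" "0 \<le> B - H v" "B - H v \<le> 2 * B" for v
      using H[of v] by (auto simp: abs_le_iff)
    then have "eventually (\<lambda>N. (\<integral>\<omega>. B + H (W \<omega>) \<partial>Q) - \<epsilon> < (\<integral>\<omega>. B + H (V N \<omega>) \<partial>P N)) sequentially"
        "eventually (\<lambda>N. (\<integral>\<omega>. B - H (W \<omega>) \<partial>Q) - \<epsilon> < (\<integral>\<omega>. B - H (V N \<omega>) \<partial>P N)) sequentially"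
      using \<open>\<epsilon> > 0\<close> by (intro lower[of _ "2 * B"]; simp)+
    with P show "eventually (\<lambda>N. dist (\<integral>\<omega>. H (V N \<omega>) \<partial>P N) (\<integral>\<omega>. H (W \<omega>) \<partial>Q) < \<epsilon>) sequentially"
    proof eventually_elim
      case (elim N)
      then show ?case
        using shift[OF Q W] shift[OF elim(1) V[of N]] by (simp add: dist_real_def abs_less_iff)
    qed
  qed
qed

section \<open>Increments along a grid of times\<close>

text \<open>Lists are chosen because \<open>nat list\<close> is a countable type, as the convergence
  criterion requires. The subtraction truncates, but is exact for nondecreasing
  \<open>F\<close>.\<close>

definition increments :: "nat \<Rightarrow> (nat \<Rightarrow> nat) \<Rightarrow> nat list" where
  "increments r F = map (\<lambda>i. F (Suc i) - F i) [0..<r]"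

lemma length_increments [simp]: "length (increments r F) = r"
  by (simp add: increments_def)

text \<open>By telescoping, the positions on the grid are a function of the increments; test
  functions of the path thus become test functions of the list.\<close>

lemma sum_list_take_increments:
  assumes "F 0 = 0" "mono_on {..r} F" "i \<le> r"
  shows "sum_list (take i (increments r F)) = F i"
  using \<open>i \<le> r\<close>
proof (induction i)
  case (Suc i)
  then have "F i \<le> F (Suc i)"
    using assms(2) by (auto simp: mono_on_def)
  then show ?case
    using Suc by (simp add: take_Suc_conv_app_nth increments_def)
qed (simp add: assms)

lemma increments_eq_iff:
  "increments r F = v \<longleftrightarrow> length v = r \<and> (\<forall>i<r. F (Suc i) - F i = v ! i)"
  by (auto simp: increments_def list_eq_iff_nth_eq)

lemma measurable_map_list:
  fixes Y :: "'i \<Rightarrow> 'a \<Rightarrow> 'c :: countable"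
  assumes "\<And>i. i \<in> set js \<Longrightarrow> Y i \<in> measurable M (count_space UNIV)"
  shows "(\<lambda>\<omega>. map (\<lambda>i. Y i \<omega>) js) \<in> measurable M (count_space UNIV)"
  using assms
proof (induction js)
  case (Cons i js)
  have Y: "Y i \<in> measurable M (count_space UNIV)"
    and rest: "(\<lambda>\<omega>. map (\<lambda>i. Y i \<omega>) js) \<in> measurable M (count_space UNIV)"
    using Cons by auto
  have "(\<lambda>\<omega>. y # map (\<lambda>i. Y i \<omega>) js) \<in> measurable M (count_space UNIV)" for y
    by (rule measurable_compose[OF rest]) simp
  from measurable_compose_countable[OF this Y] show ?case
    by simp
qed simp

context poisson_process
begin

lemma measurable_increments:
  assumes "t ` {..r} \<subseteq> T" "strict_mono_on {..r} t"
  shows "(\<lambda>\<omega>. increments r (\<lambda>i. X (t i) \<omega>)) \<in> measurable M (count_space UNIV)"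
  unfolding increments_def
proof (rule measurable_map_list)
  show "(\<lambda>\<omega>. X (t (Suc i)) \<omega> - X (t i) \<omega>) \<in> measurable M (count_space UNIV)" if "i \<in> set [0..<r]" for i
    using independent_increments[OF assms] that by (auto simp: indep_vars_def)
qed

lemma prob_increments:
  assumes t: "t ` {..r} \<subseteq> T" "strict_mono_on {..r} t" and "r > 0" "length v = r"
  shows "prob ((\<lambda>\<omega>. increments r (\<lambda>i. X (t i) \<omega>)) -` {v} \<inter> space M)
    = (\<Prod>i<r. pmf (poisson_pmf (rate * (t (Suc i) - t i))) (v ! i))"
proof -
  let ?Y = "\<lambda>i \<omega>. X (t (Suc i)) \<omega> - X (t i) \<omega>"
  have ind: "indep_vars (\<lambda>_. count_space UNIV) ?Y {..<r}"
    using independent_increments[OF t] .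
  have "prob (?Y i -` {k} \<inter> space M) = pmf (poisson_pmf (rate * (t (Suc i) - t i))) k" if "i < r" for i k
  proof -
    have "?Y i \<in> measurable M (count_space UNIV)"
      using ind that by (auto simp: indep_vars_def)
    then have "prob (?Y i -` {k} \<inter> space M) = measure (distr M (count_space UNIV) (?Y i)) {k}"
      by (subst measure_distr) auto
    also have "distr M (count_space UNIV) (?Y i) = measure_pmf (poisson_pmf (rate * (t (Suc i) - t i)))"
      using t that by (intro poisson_increments) (auto simp: strict_mono_on_def)
    finally show ?thesis
      by (simp add: measure_pmf_single)
  qed
  \<comment> \<open>With \<open>r > 0\<close> the intersection is over a non-empty family and so
    stays inside \<open>space M\<close>.\<close>
  moreover have "(\<lambda>\<omega>. increments r (\<lambda>i. X (t i) \<omega>)) -` {v} \<inter> space M = (\<Inter>i\<in>{..<r}. ?Y i -` {v ! i} \<inter> space M)"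
    using \<open>r > 0\<close> \<open>length v = r\<close> by (auto simp: increments_eq_iff)
  ultimately show ?thesis
    using indep_varsD_finite[OF ind, of "\<lambda>i. {v ! i}"] \<open>r > 0\<close> by (simp add: lessThan_empty_iff)
qed

end

text \<open>The steps are taken in \<open>{0, 1}\<close> and vanish at the times \<open>K 1, \<dots>, K r\<close>.\<close>

lemma step_sequences_with_increments:
  assumes K: "K 0 = 0" "K r = N" "mono_on {..r} K" and v: "length v = r" and "N \<ge> 1"
  obtains G where "finite G" "G \<subseteq> {1..N} \<rightarrow>\<^sub>E UNIV"
    "card G = (\<Prod>i<r. (K (Suc i) - Suc (K i)) choose (v ! i))"
    "\<And>m. m \<in> G \<Longrightarrow> m N = 0"
    "\<And>m. m \<in> G \<Longrightarrow> partial_sum m N = sum_list v"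
    "\<And>m. m \<in> G \<Longrightarrow> increments r (\<lambda>i. partial_sum m (K i)) = v"
proof -
  \<comment> \<open>Leaving out the right endpoint makes the step at \<open>N = K r\<close> vanish,
    so that \<open>m\<close> has the same partial sum at \<open>N - 1\<close> as at
    \<open>N\<close>; the candidate term of index \<open>N\<close> sees the former. It costs one
    site per block, which is invisible in the limit.\<close>
  define B where "B i = {K i<..<K (Suc i)}" for i
  define D where "D = (\<Pi>\<^sub>E i\<in>{..<r}. {s. s \<subseteq> B i \<and> card s = v ! i})"
  define ind :: "(nat \<Rightarrow> nat set) \<Rightarrow> nat \<Rightarrow> nat" where
    "ind S = (\<lambda>j\<in>{1..N}. if \<exists>i<r. j \<in> S i then 1 else 0)" for S
  have K_mono: "K i \<le> K j" if "i \<le> j" "j \<le> r" for i j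
    using K(3) that by (auto simp: mono_on_def)
  have B_sub: "B i \<subseteq> {1..N}" "N \<notin> B i" if "i < r" for i
    using that K(2) K_mono[of "Suc i" r] unfolding B_def by auto
  \<comment> \<open>One block is open and the other contains its right endpoint: the indicator must
    be controlled at the endpoints too, since the increments sum over half-open blocks.\<close>
  have B_disj: "i = i'" if "j \<in> B i" "j \<in> {K i'<..K (Suc i')}" "i < r" "i' < r" for i i' j
  proof (rule ccontr)
    assume "i \<noteq> i'"
    then consider "Suc i \<le> i'" | "Suc i' \<le> i"
      by linarith
    then show False
      using that K_mono[of "Suc i" i'] K_mono[of "Suc i'" i] unfolding B_def by cases auto
  qed
  have ind_block: "ind S j = (if j \<in> S i then 1 else 0)"
    if "S \<in> D" "i < r" "j \<in> {K i<..K (Suc i)}" for S i j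
  proof -
    have "j \<in> {1..N}"
      using that K(2) K_mono[of "Suc i" r] by auto
    moreover have "(\<exists>i'<r. j \<in> S i') \<longleftrightarrow> j \<in> S i"
      using that B_disj[of j _ i] unfolding D_def by (fastforce simp: PiE_iff)
    ultimately show ?thesis
      by (simp add: ind_def)
  qed
  have step: "partial_sum (ind S) (K (Suc i)) = partial_sum (ind S) (K i) + v ! i"
    if "S \<in> D" "i < r" for S i
  proof -
    have S: "S i \<subseteq> B i" "card (S i) = v ! i"
      using that unfolding D_def by (auto simp: PiE_iff)
    have "(\<Sum>j\<in>{K i<..K (Suc i)}. ind S j) = (\<Sum>j\<in>{K i<..K (Suc i)}. if j \<in> S i then 1 else 0)"
      using ind_block[OF that] by (intro sum.cong) auto
    also have "\<dots> = card ({K i<..K (Suc i)} \<inter> S i)"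
      by (simp add: sum.If_cases)
    also have "{K i<..K (Suc i)} \<inter> S i = S i"
      using S(1) unfolding B_def by auto
    finally show ?thesis
      using S(2) partial_sum_diff[of "K i" "K (Suc i)" "ind S"] K_mono[of i "Suc i"] that by simp
  qed
  have take: "partial_sum (ind S) (K i) = sum_list (take i v)" if "S \<in> D" "i \<le> r" for S i
    using \<open>i \<le> r\<close>
  proof (induction i)
    case 0
    then show ?case
      by (simp add: K partial_sum_def)
  next
    case (Suc i)
    then show ?case
      using step[OF \<open>S \<in> D\<close>, of i] v by (simp add: take_Suc_conv_app_nth)
  qed
  have inj: "inj_on ind D"
  proof (rule inj_onI)
    fix S S' assume SS: "S \<in> D" "S' \<in> D" "ind S = ind S'"
    have "S i = S' i" if "i < r" for i
    proof -
      \<comment> \<open>The chosen sets can be read back from the indicator block by block, which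
        gives injectivity and hence the cardinality.\<close>
      have *: "R i = {j \<in> B i. ind R j = 1}" if "R \<in> D" for R
      proof -
        have "R i \<subseteq> B i"
          using that \<open>i < r\<close> unfolding D_def by (auto simp: PiE_iff)
        moreover have "ind R j = (if j \<in> R i then 1 else 0)" if "j \<in> B i" for j
          using ind_block[OF \<open>R \<in> D\<close> \<open>i < r\<close>] that by (simp add: B_def)
        then have "ind R j = 1 \<longleftrightarrow> j \<in> R i" if "j \<in> B i" for j
          using that by simp
        ultimately show ?thesis
          by blast
      qed
      show ?thesis
        using *[OF SS(1)] *[OF SS(2)] SS(3) by simp
    qed
    then show "S = S'"
      using SS unfolding D_def by (intro PiE_ext) auto
  qed
  have fin: "finite D"
    unfolding D_def by (intro finite_PiE) (auto simp: B_def)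
  have "card D = (\<Prod>i<r. (K (Suc i) - Suc (K i)) choose (v ! i))"
    unfolding D_def by (simp add: card_PiE n_subsets B_def)
  show thesis
  proof (rule that[of "ind ` D"])
    show "finite (ind ` D)"
      using fin by simp
    show "ind ` D \<subseteq> {1..N} \<rightarrow>\<^sub>E UNIV"
      unfolding ind_def by auto
    show "card (ind ` D) = (\<Prod>i<r. (K (Suc i) - Suc (K i)) choose (v ! i))"
      using card_image[OF inj] \<open>card D = _\<close> by simp
    fix m assume "m \<in> ind ` D"
    then obtain S where S: "S \<in> D" "m = ind S"
      by blast
    show "m N = 0"
      using S B_sub(2) \<open>N \<ge> 1\<close> unfolding ind_def D_def by (fastforce simp: PiE_iff)
    show "partial_sum m N = sum_list v"
      using take[OF S(1), of r] K(2) v S(2) by simp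
    show "increments r (\<lambda>i. partial_sum m (K i)) = v"
      using step[OF S(1)] v S(2) by (simp add: increments_eq_iff)
  qed
qed

section \<open>Elementary limits behind the Poisson probabilities\<close>

lemma tendsto_zero_of_times_nat:
  fixes p :: "nat \<Rightarrow> real"
  assumes p: "(\<lambda>N. real N * p N) \<longlonglongrightarrow> \<mu>"
  shows "p \<longlonglongrightarrow> 0"
proof -
  have "(\<lambda>N. real N * p N * (1 / real N)) \<longlonglongrightarrow> \<mu> * 0"
    by (intro tendsto_mult p lim_1_over_n)
  then have "(\<lambda>N. real N * p N * (1 / real N)) \<longlonglongrightarrow> 0"
    by simp
  then show ?thesis
    by (rule Lim_transform_eventually) (auto simp: eventually_sequentially intro!: exI[of _ 1])
qed

text \<open>Distributing \<open>p N ^ k\<close> over the falling factorial gives \<open>k\<close>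
  factors \<open>(b N - i) * p N\<close>; each tends to \<open>\<delta> * \<mu>\<close> because
  \<open>i * p N\<close> vanishes.\<close>

lemma tendsto_choose_times_power:
  fixes p :: "nat \<Rightarrow> real" and b :: "nat \<Rightarrow> nat"
  assumes b: "(\<lambda>N. real (b N) / real N) \<longlonglongrightarrow> \<delta>" and p: "(\<lambda>N. real N * p N) \<longlonglongrightarrow> \<mu>"
  shows "(\<lambda>N. real (b N choose k) * p N ^ k) \<longlonglongrightarrow> (\<delta> * \<mu>) ^ k / fact k"
proof -
  have p0: "p \<longlonglongrightarrow> 0"
    using p by (rule tendsto_zero_of_times_nat)
  have "(\<lambda>N. (real (b N) / real N) * (real N * p N)) \<longlonglongrightarrow> \<delta> * \<mu>"
    by (intro tendsto_mult b p)
  then have "(\<lambda>N. real (b N) * p N) \<longlonglongrightarrow> \<delta> * \<mu>"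
    by (rule Lim_transform_eventually) (auto simp: eventually_sequentially intro!: exI[of _ 1])
  then have "(\<lambda>N. (\<Prod>i = 0..<k. real (b N) * p N - real i * p N) / fact k)
      \<longlonglongrightarrow> (\<Prod>i = 0..<k. \<delta> * \<mu> - real i * 0) / fact k"
    by (intro tendsto_prod tendsto_divide tendsto_diff tendsto_mult_left p0 tendsto_const) simp_all
  moreover have "real (b N choose k) * p N ^ k = (\<Prod>i = 0..<k. real (b N) * p N - real i * p N) / fact k" for N
    by (simp add: binomial_gbinomial gbinomial_prod_rev prod.distrib flip: left_diff_distrib)
  ultimately show ?thesis
    by simp
qed

text \<open>After taking logarithms, \<open>ln (1 - p)\<close> lies between
  \<open>- p - 2 * p^2\<close> and \<open>- p\<close>, and \<open>N * p^2\<close> tends to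
  0.\<close>

lemma tendsto_power_exp:
  fixes p :: "nat \<Rightarrow> real"
  assumes p: "(\<lambda>N. real N * p N) \<longlonglongrightarrow> \<mu>" and p_nonneg: "eventually (\<lambda>N. 0 \<le> p N) sequentially"
  shows "(\<lambda>N. (1 - p N) ^ N) \<longlonglongrightarrow> exp (- \<mu>)"
proof -
  have p0: "p \<longlonglongrightarrow> 0"
    using p by (rule tendsto_zero_of_times_nat)
  have "(\<lambda>N. - (real N * p N) - 2 * (real N * p N) * p N) \<longlonglongrightarrow> - \<mu> - 2 * \<mu> * 0"
    by (intro tendsto_intros p p0)
  then have low: "(\<lambda>N. - (real N * p N) - 2 * (real N * p N) * p N) \<longlonglongrightarrow> - \<mu>"
    by simp
  have small: "eventually (\<lambda>N. p N < 1 / 2) sequentially"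
    using p0 by (rule order_tendstoD) simp
  have "(\<lambda>N. real N * ln (1 - p N)) \<longlonglongrightarrow> - \<mu>"
  proof (rule tendsto_sandwich[OF _ _ low tendsto_minus[OF p]])
    show "eventually (\<lambda>N. - (real N * p N) - 2 * (real N * p N) * p N \<le> real N * ln (1 - p N)) sequentially"
      using p_nonneg small
    proof eventually_elim
      case (elim N)
      then have "real N * (- p N - 2 * (p N)\<^sup>2) \<le> real N * ln (1 - p N)"
        by (intro mult_left_mono ln_one_minus_pos_lower_bound) auto
      then show ?case
        by (simp add: algebra_simps power2_eq_square)
    qed
    show "eventually (\<lambda>N. real N * ln (1 - p N) \<le> - (real N * p N)) sequentially"
      using small
    proof eventually_elim
      case (elim N)
      then have "real N * ln (1 - p N) \<le> real N * - p N"
        using ln_le_minus_one[of "1 - p N"] by (intro mult_left_mono) auto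
      then show ?case
        by simp
    qed
  qed
  then have "(\<lambda>N. exp (real N * ln (1 - p N))) \<longlonglongrightarrow> exp (- \<mu>)"
    by (rule tendsto_exp)
  moreover have "eventually (\<lambda>N. exp (real N * ln (1 - p N)) = (1 - p N) ^ N) sequentially"
    using small by eventually_elim (simp add: exp_of_nat_mult)
  ultimately show ?thesis
    by (rule Lim_transform_eventually)
qed

text \<open>The number of free sites in a block differs from \<open>N * (t - s)\<close> by at most
  2, so division by \<open>N\<close> removes the effect of rounding and of the excluded
  endpoint.\<close>

lemma tendsto_floor_block:
  assumes "0 \<le> s" "s < t"
  shows "(\<lambda>N. real (nat \<lfloor>real N * t\<rfloor> - Suc (nat \<lfloor>real N * s\<rfloor>)) / real N) \<longlonglongrightarrow> t - s"
proof (rule tendsto_sandwich)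
  have bounds: "real N * (t - s) - 2 \<le> real (nat \<lfloor>real N * t\<rfloor> - Suc (nat \<lfloor>real N * s\<rfloor>))
     \<and> real (nat \<lfloor>real N * t\<rfloor> - Suc (nat \<lfloor>real N * s\<rfloor>)) \<le> real N * (t - s)" for N
  proof -
    define k l where "k = nat \<lfloor>real N * s\<rfloor>" and "l = nat \<lfloor>real N * t\<rfloor>"
    have k: "real k \<le> real N * s" "real N * s < real k + 1"
      unfolding k_def using assms by (simp_all add: of_nat_nat)
    have l: "real l \<le> real N * t" "real N * t < real l + 1"
      unfolding l_def using assms by (simp_all add: of_nat_nat)
    have le: "real N * s \<le> real N * t"
      using assms by (intro mult_left_mono) auto
    show ?thesis
    proof (cases "Suc k \<le> l")
      case True
      then have "real (l - Suc k) = real l - real k - 1"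
        by (simp add: of_nat_diff)
      then show ?thesis
        unfolding k_def[symmetric] l_def[symmetric] right_diff_distrib using k l by linarith
    next
      \<comment> \<open>Here the subtraction truncates to 0, which forces
        \<open>N * (t - s) < 1\<close>.\<close>
      case False
      then have "real (l - Suc k) = 0" "real l \<le> real k"
        by simp_all
      then show ?thesis
        unfolding k_def[symmetric] l_def[symmetric] right_diff_distrib using k l le by linarith
    qed
  qed
  then have "(real N * (t - s) - 2) / real N \<le> real (nat \<lfloor>real N * t\<rfloor> - Suc (nat \<lfloor>real N * s\<rfloor>)) / real N"
      "real (nat \<lfloor>real N * t\<rfloor> - Suc (nat \<lfloor>real N * s\<rfloor>)) / real N \<le> real N * (t - s) / real N" for N
    by (intro divide_right_mono; simp)+
  then show "eventually (\<lambda>N. (real N * (t - s) - 2) / real N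
      \<le> real (nat \<lfloor>real N * t\<rfloor> - Suc (nat \<lfloor>real N * s\<rfloor>)) / real N) sequentially"
    "eventually (\<lambda>N. real (nat \<lfloor>real N * t\<rfloor> - Suc (nat \<lfloor>real N * s\<rfloor>)) / real N
      \<le> real N * (t - s) / real N) sequentially"
    by auto
  show "(\<lambda>N. (real N * (t - s) - 2) / real N) \<longlonglongrightarrow> t - s" "(\<lambda>N. real N * (t - s) / real N) \<longlonglongrightarrow> t - s"
    by real_asymp+
qed

section \<open>The normalised measure and a lower bound for the law of its increments\<close>

lemma space_P_Geo: "space (P_Geo N a c1 c2) = step_pairs N"
  by (simp add: P_Geo_def space_point_measure)

lemma measurable_P_Geo: "V \<in> measurable (P_Geo N a c1 c2) (count_space UNIV)"
  by (simp add: P_Geo_def)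

context
  fixes N :: nat and a c1 c2 :: real
  assumes pos: "a > 0" "c1 > 0" "c2 > 0"
    and summable: "(\<lambda>(m, n). weight N a c1 c2 (partial_sum m) (partial_sum n)) summable_on step_pairs N"
begin

text \<open>The pair of null step sequences alone already contributes a positive weight.\<close>

lemma partition_fun_pos: "partition_fun N a c1 c2 > 0"
proof -
  define z :: "nat \<Rightarrow> nat" where "z = (\<lambda>j\<in>{1..N}. 0)"
  have "0 < weight N a c1 c2 (partial_sum z) (partial_sum z)"
    unfolding weight_def using pos by simp
  also have "\<dots> = (\<Sum>x\<in>{(z, z)}. case x of (m, n) \<Rightarrow> weight N a c1 c2 (partial_sum m) (partial_sum n))"
    by simp
  also have "\<dots> \<le> partition_fun N a c1 c2"
    unfolding partition_fun_def
    by (intro finite_sum_le_infsum summable) (use pos in \<open>auto simp: step_pairs_def z_def weight_nonneg\<close>)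
  finally show ?thesis .
qed

lemma emeasure_P_Geo:
  assumes "A \<subseteq> step_pairs N"
  shows "emeasure (P_Geo N a c1 c2) A
    = ennreal ((\<Sum>\<^sub>\<infinity>(m, n)\<in>A. weight N a c1 c2 (partial_sum m) (partial_sum n)) / partition_fun N a c1 c2)"
proof -
  let ?w = "\<lambda>(m, n). weight N a c1 c2 (partial_sum m) (partial_sum n)"
  let ?Z = "partition_fun N a c1 c2"
  have "P_Geo N a c1 c2 = point_measure (step_pairs N) (\<lambda>x. ennreal (?w x / ?Z))"
    unfolding P_Geo_def by (simp add: case_prod_unfold)
  moreover have "emeasure (point_measure (step_pairs N) (\<lambda>x. ennreal (?w x / ?Z))) A
      = ennreal (infsum (\<lambda>x. ?w x / ?Z) A)"
    using summable_on_cmult_left[OF summable, of "inverse ?Z"] pos partition_fun_pos assms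
    by (intro emeasure_point_measure_infsum) (auto simp: weight_nonneg divide_inverse)
  moreover have "infsum (\<lambda>x. ?w x / ?Z) A = infsum ?w A / ?Z"
    by (simp add: divide_inverse infsum_cmult_left')
  ultimately show ?thesis
    by simp
qed

lemma prob_space_P_Geo: "prob_space (P_Geo N a c1 c2)"
proof (rule prob_spaceI)
  show "emeasure (P_Geo N a c1 c2) (space (P_Geo N a c1 c2)) = 1"
    using emeasure_P_Geo[of "step_pairs N"] partition_fun_pos
    by (simp add: space_P_Geo flip: partition_fun_def)
qed

text \<open>The event contains \<open>m\<close> from the counted family combined with arbitrary
  \<open>n\<close>. Summing the geometric bound over \<open>n\<close> produces
  \<open>(1 / (1 - q)) ^ N\<close>, the same factor as in the bound on the partition function. The
  exact cancellation matters: in case (a) this factor diverges, and only \<open>U\<close> has a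
  limit.\<close>

lemma prob_P_Geo_increments_ge:
  assumes "N \<ge> 1" and p: "0 \<le> p" and q: "0 \<le> q" "q < 1"
    and Z_le: "partition_fun N a c1 c2 \<le> (1 / (1 - q)) ^ N * U"
    and weight_ge: "\<And>m n. m N = 0 \<Longrightarrow>
      p ^ partial_sum m N * q ^ partial_sum n N \<le> weight N a c1 c2 (partial_sum m) (partial_sum n)"
    and K: "K 0 = 0" "K r = N" "mono_on {..r} K" and v: "length v = r"
  shows "(\<Prod>i<r. real ((K (Suc i) - Suc (K i)) choose (v ! i)) * p ^ (v ! i)) / U
    \<le> measure (P_Geo N a c1 c2)
        ((\<lambda>\<omega>. increments r (\<lambda>i. partial_sum (fst \<omega>) (K i))) -` {v} \<inter> space (P_Geo N a c1 c2))"
    (is "?L / U \<le> measure ?P ?A")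
proof -
  let ?w = "\<lambda>(m, n). weight N a c1 c2 (partial_sum m) (partial_sum n)"
  let ?Z = "partition_fun N a c1 c2"
  let ?E = "{1..N} \<rightarrow>\<^sub>E (UNIV :: nat set)"
  obtain G where G: "finite G" "G \<subseteq> ?E"
    "card G = (\<Prod>i<r. (K (Suc i) - Suc (K i)) choose (v ! i))"
    "\<And>m. m \<in> G \<Longrightarrow> m N = 0"
    "\<And>m. m \<in> G \<Longrightarrow> partial_sum m N = sum_list v"
    "\<And>m. m \<in> G \<Longrightarrow> increments r (\<lambda>i. partial_sum m (K i)) = v"
    by (rule step_sequences_with_increments[OF K v \<open>N \<ge> 1\<close>]) (rule that, simp_all)
  have A: "?A \<subseteq> step_pairs N" "G \<times> ?E \<subseteq> ?A"
    using G(2,6) by (auto simp: space_P_Geo step_pairs_def)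
  have Z: "?Z > 0"
    by (rule partition_fun_pos)
  have "p ^ sum_list v = (\<Prod>i<r. p ^ (v ! i))"
    using v by (simp add: sum_list_sum_nth power_sum atLeast0LessThan)
  then have L_eq: "?L = real (card G) * p ^ sum_list v"
    by (simp add: G(3) prod.distrib)
  have "((\<lambda>m. p ^ partial_sum m N) has_sum real (card G) * p ^ sum_list v) G"
    using has_sum_finite[OF G(1), of "\<lambda>m. p ^ partial_sum m N"] G(5) by simp
  moreover have "((\<lambda>n. q ^ partial_sum n N) has_sum (1 / (1 - q)) ^ N) ?E"
    using has_sum_prod_geometric[of "{1..N}" "\<lambda>_. q"] q by (simp add: partial_sum_def power_sum)
  ultimately have main: "((\<lambda>(m, n). p ^ partial_sum m N * q ^ partial_sum n N)
      has_sum ?L * (1 / (1 - q)) ^ N) (G \<times> ?E)"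
    unfolding L_eq using p q by (intro has_sum_times_nonneg) auto
  have sum_A: "?w summable_on ?A"
    using summable A(1) by (rule summable_on_subset_banach)
  have "?L * (1 / (1 - q)) ^ N = infsum (\<lambda>(m, n). p ^ partial_sum m N * q ^ partial_sum n N) (G \<times> ?E)"
    using main by (simp add: infsumI)
  also have "\<dots> \<le> infsum ?w ?A"
  proof (rule infsum_mono_neutral)
    show "(\<lambda>(m, n). p ^ partial_sum m N * q ^ partial_sum n N) summable_on G \<times> ?E"
      using main by (rule has_sum_imp_summable)
    show "?w summable_on ?A"
      by (fact sum_A)
    show "(case x of (m, n) \<Rightarrow> p ^ partial_sum m N * q ^ partial_sum n N) \<le> ?w x" if "x \<in> (G \<times> ?E) \<inter> ?A" for x
      using that G(4) weight_ge by auto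
    show "(case x of (m, n) \<Rightarrow> p ^ partial_sum m N * q ^ partial_sum n N) \<le> 0" if "x \<in> G \<times> ?E - ?A" for x
      using that A(2) by blast
    show "0 \<le> ?w x" for x
      using pos by (cases x) (auto simp: weight_nonneg)
  qed
  finally have *: "?L * (1 / (1 - q)) ^ N \<le> infsum ?w ?A" .
  have "?L \<ge> 0"
    using p by (intro prod_nonneg) auto
  \<comment> \<open>The sign of \<open>U\<close> follows from positivity of the partition function
    below it.\<close>
  have "0 < (1 / (1 - q)) ^ N * U"
    using Z Z_le by linarith
  then have "U > 0"
    using q by (simp add: zero_less_mult_iff zero_less_divide_iff)
  have "?L / U = ?L * (1 / (1 - q)) ^ N / ((1 / (1 - q)) ^ N * U)"
    using q by simp
  also have "\<dots> \<le> ?L * (1 / (1 - q)) ^ N / ?Z"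
    using Z Z_le q \<open>?L \<ge> 0\<close> \<open>U > 0\<close> by (intro divide_left_mono) auto
  also have "\<dots> \<le> infsum ?w ?A / ?Z"
    using * Z by (intro divide_right_mono) auto
  also have "\<dots> = measure ?P ?A"
  proof -
    have "infsum ?w ?A \<ge> 0"
      using pos by (intro infsum_nonneg) (auto simp: weight_nonneg)
    then show ?thesis
      using emeasure_P_Geo[OF A(1)] Z by (simp add: measure_def)
  qed
  finally show ?thesis .
qed

end

section \<open>Upper bounds for the partition function\<close>

lemma has_sum_finite_sum:
  fixes f :: "'i \<Rightarrow> 'a \<Rightarrow> 'b :: topological_comm_monoid_add"
  assumes "finite I" "\<And>i. i \<in> I \<Longrightarrow> (f i has_sum s i) A"
  shows "((\<lambda>x. \<Sum>i\<in>I. f i x) has_sum (\<Sum>i\<in>I. s i)) A"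
  using assms by (induction I rule: finite_induct) (auto intro: has_sum_add)

lemma partition_fun_le_of_has_sum:
  assumes "(g has_sum s) (step_pairs N)" "a \<ge> 0" "c1 \<ge> 0" "c2 \<ge> 0"
    and "\<And>m n. weight N a c1 c2 (partial_sum m) (partial_sum n) \<le> g (m, n)"
  shows "(\<lambda>(m, n). weight N a c1 c2 (partial_sum m) (partial_sum n)) summable_on step_pairs N"
    and "partition_fun N a c1 c2 \<le> s"
proof -
  show summable: "(\<lambda>(m, n). weight N a c1 c2 (partial_sum m) (partial_sum n)) summable_on step_pairs N"
    using has_sum_imp_summable[OF assms(1)] by (rule summable_on_comparison_test) (use assms in \<open>auto simp: weight_nonneg\<close>)
  show "partition_fun N a c1 c2 \<le> s"
    unfolding partition_fun_def
    by (rule has_sum_mono[OF has_sum_infsum[OF summable] assms(1)]) (use assms in auto)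
qed

text \<open>The decoupled bound on the weight sums to a product; in case (b) its second factor tends
  to 1.\<close>

lemma partition_fun_bound_product:
  assumes "N \<ge> 1" "a > 0" "c1 > 0" "c2 > 0" "c1 * c2 \<ge> 1" "a * c1 < 1" "a * c2 < 1"
  shows "(\<lambda>(m, n). weight N a c1 c2 (partial_sum m) (partial_sum n)) summable_on step_pairs N"
    and "partition_fun N a c1 c2 \<le> (1 / (1 - a * c2)) ^ N * (1 / (1 - a * c1)) ^ N"
proof -
  have "((\<lambda>(m, n). (a * c2) ^ partial_sum m N * (a * c1) ^ partial_sum n N)
      has_sum (1 / (1 - a * c2)) ^ N * (1 / (1 - a * c1)) ^ N) (step_pairs N)"
    \<comment> \<open>Splitting both paths at \<open>N\<close> leaves nothing after the split, so
      the dummy parameters 0 enter only as \<open>0 ^ 0 = 1\<close>.\<close>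
    using has_sum_geometric_split[of N N N "a * c2" 0 "a * c1" 0] assms by simp
  note * = partition_fun_le_of_has_sum[OF this]
  show "(\<lambda>(m, n). weight N a c1 c2 (partial_sum m) (partial_sum n)) summable_on step_pairs N"
    using assms weight_le_powers[OF assms(1-5)] by (intro *(1)) auto
  show "partition_fun N a c1 c2 \<le> (1 / (1 - a * c2)) ^ N * (1 / (1 - a * c1)) ^ N"
    using assms weight_le_powers[OF assms(1-5)] by (intro *(2)) auto
qed

text \<open>Bounding the maximum by the sum over the maximising index \<open>j\<close> loses only a geometric
  factor: the term of index \<open>j\<close> is at most \<open>s ^ (N - j)\<close> times that of index \<open>N\<close>.\<close>

lemma partition_fun_bound_last_term:
  fixes a c1 c2 :: real
  defines "s \<equiv> (1 - a * c1) / ((1 - a / c2) * (1 - a * c2))"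
  assumes "N \<ge> 1" and pos: "a > 0" "c1 > 0" "c2 > 0"
    and lt: "a * c1 < 1" "a * c2 < 1" "a / c1 < 1" "a / c2 < 1" and "s < 1"
  shows "(\<lambda>(m, n). weight N a c1 c2 (partial_sum m) (partial_sum n)) summable_on step_pairs N"
    and "partition_fun N a c1 c2
      \<le> (1 / (1 - a * c1)) ^ N * ((1 / (1 - a / c1)) ^ N * (1 / (1 - a * c2)) * (1 / (1 - s)))"
proof -
  define b where "b j = (1 / (1 - a / c1)) ^ (j - 1) * (1 / (1 - a * c2)) ^ (N - (j - 1))
      * ((1 / (1 - a * c1)) ^ j * (1 / (1 - a / c2)) ^ (N - j))" for j
  have "((\<lambda>(m, n). max_term N a c1 c2 j (partial_sum m) (partial_sum n)) has_sum b j) (step_pairs N)"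
    if "j \<in> {1..N}" for j
  proof -
    have "j - 1 \<le> N" "j \<le> N"
      using that by auto
    from has_sum_geometric_split[OF this, of "a / c1" "a * c2" "a * c1" "a / c2"] show ?thesis
      using \<open>j \<le> N\<close> pos lt by (simp add: max_term_eq b_def)
  qed
  then have "((\<lambda>x. \<Sum>j=1..N. case x of (m, n) \<Rightarrow> max_term N a c1 c2 j (partial_sum m) (partial_sum n))
      has_sum (\<Sum>j=1..N. b j)) (step_pairs N)"
    by (intro has_sum_finite_sum) auto
  note * = partition_fun_le_of_has_sum[OF this]
  show "(\<lambda>(m, n). weight N a c1 c2 (partial_sum m) (partial_sum n)) summable_on step_pairs N"
    using pos weight_le_sum_max_term[OF \<open>N \<ge> 1\<close>] by (intro *(1)) auto
  have "partition_fun N a c1 c2 \<le> (\<Sum>j=1..N. b j)"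
    using pos weight_le_sum_max_term[OF \<open>N \<ge> 1\<close>] by (intro *(2)) auto
  also have "\<dots> \<le> (\<Sum>j=1..N. (1 / (1 - a * c1)) ^ N * ((1 / (1 - a / c1)) ^ N * (1 / (1 - a * c2)) * s ^ (N - j)))"
  proof (rule sum_mono)
    fix j assume j: "j \<in> {1..N}"
    define i where "i = N - j"
    \<comment> \<open>The first path splits at \<open>j - 1\<close>, so \<open>Suc i\<close> of its
      sites follow the split; this leaves the single extra factor \<open>1 / (1 - a * c2)\<close> in
      the bound.\<close>
    have N: "N = j + i" "N - (j - 1) = Suc i"
      using j by (auto simp: i_def)
    have "b j = (1 / (1 - a / c1)) ^ (j - 1) * ((1 / (1 - a * c1)) ^ N * (1 / (1 - a * c2)) * s ^ i)"
      unfolding b_def s_def N(2) i_def[symmetric]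
      unfolding N(1) using lt by (simp add: power_add power_divide power_mult_distrib)
    \<comment> \<open>The base \<open>1 / (1 - a / c1)\<close> is at least 1, so its exponent may be
      raised to \<open>N\<close>; the remaining dependence on \<open>j\<close> is the pure power
      \<open>s ^ i\<close>.\<close>
    also have "\<dots> \<le> (1 / (1 - a / c1)) ^ N * ((1 / (1 - a * c1)) ^ N * (1 / (1 - a * c2)) * s ^ i)"
      using lt pos j unfolding s_def by (intro mult_right_mono power_increasing) auto
    finally show "b j \<le> (1 / (1 - a * c1)) ^ N * ((1 / (1 - a / c1)) ^ N * (1 / (1 - a * c2)) * s ^ (N - j))"
      by (simp add: i_def mult_ac)
  qed
  also have "\<dots> = (1 / (1 - a * c1)) ^ N * ((1 / (1 - a / c1)) ^ N * (1 / (1 - a * c2)) * (\<Sum>j=1..N. s ^ (N - j)))"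
    by (simp add: sum_distrib_left)
  also have "(\<Sum>j=1..N. s ^ (N - j)) = (\<Sum>i<N. s ^ i)"
    by (rule sum.reindex_bij_witness[of _ "\<lambda>i. N - i" "\<lambda>j. N - j"]) auto
  also have "(1 / (1 - a * c1)) ^ N * ((1 / (1 - a / c1)) ^ N * (1 / (1 - a * c2)) * (\<Sum>i<N. s ^ i))
      \<le> (1 / (1 - a * c1)) ^ N * ((1 / (1 - a / c1)) ^ N * (1 / (1 - a * c2)) * (1 / (1 - s)))"
  proof (intro mult_left_mono)
    have "s \<ge> 0"
      unfolding s_def using lt by simp
    then show "(\<Sum>i<N. s ^ i) \<le> 1 / (1 - s)"
      using \<open>s < 1\<close> by (simp add: sum_gp_strict divide_right_mono)
  qed (use lt in auto)
  finally show "partition_fun N a c1 c2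
      \<le> (1 / (1 - a * c1)) ^ N * ((1 / (1 - a / c1)) ^ N * (1 / (1 - a * c2)) * (1 / (1 - s)))" .
qed

section \<open>From bounds on the weight to finite-dimensional convergence\<close>

text \<open>Since \<open>0 ^ 0 = 1\<close>, taking \<open>q N = 0\<close> restricts the lower bound on the weight to \<open>n = 0\<close>.\<close>

lemma fdd_converges_of_weight_bounds:
  fixes lam :: real and a c1 c2 p q U :: "nat \<Rightarrow> real"
    and M :: "'w measure" and X :: "real \<Rightarrow> 'w \<Rightarrow> nat"
  assumes poisson: "poisson_process M {0..1} lam X" and "lam > 0"
    and pos: "eventually (\<lambda>N. a N > 0 \<and> c1 N > 0 \<and> c2 N > 0) sequentially"
    and summable: "eventually (\<lambda>N. (\<lambda>(m, n). weight N (a N) (c1 N) (c2 N) (partial_sum m) (partial_sum n))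
      summable_on step_pairs N) sequentially"
    and pq: "eventually (\<lambda>N. 0 \<le> p N \<and> 0 \<le> q N \<and> q N < 1) sequentially"
    and Z_le: "eventually (\<lambda>N. partition_fun N (a N) (c1 N) (c2 N) \<le> (1 / (1 - q N)) ^ N * U N) sequentially"
    and weight_ge: "eventually (\<lambda>N. \<forall>m n. m N = 0 \<longrightarrow> p N ^ partial_sum m N * q N ^ partial_sum n N
      \<le> weight N (a N) (c1 N) (c2 N) (partial_sum m) (partial_sum n)) sequentially"
    and p_lim: "(\<lambda>N. real N * p N) \<longlonglongrightarrow> lam" and U_lim: "U \<longlonglongrightarrow> exp lam"
  shows "fdd_converges (\<lambda>N. P_Geo N (a N) (c1 N) (c2 N))
    (\<lambda>N x \<omega>. real (partial_sum (fst \<omega>) (nat \<lfloor>real N * x\<rfloor>))) M (\<lambda>x \<omega>. real (X x \<omega>)) {0..1}"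
  unfolding fdd_converges_def
proof (intro allI impI)
  fix J :: "real set" and f :: "(real \<Rightarrow> real) \<Rightarrow> real"
  assume J: "finite J" "J \<subseteq> {0..1}" and f: "bounded (f ` (J \<rightarrow>\<^sub>E UNIV))"
  interpret poisson_process M "{0..1}" lam X by fact
  \<comment> \<open>Adding the times 0 and 1 makes the increments cover the whole interval: the last
    grid point is \<open>K N r = N\<close>, and the block lengths sum to 1.\<close>
  define ts where "ts = sorted_list_of_set (insert 0 (insert 1 J))"
  define t where "t i = ts ! i" for i
  define r where "r = length ts - 1"
  have set_ts: "set ts = insert 0 (insert 1 J)"
    unfolding ts_def using J by (intro set_sorted_list_of_set) simp
  have ts_sorted: "sorted_wrt (<) ts"
    unfolding ts_def by (rule strict_sorted_list_of_set)
  have len: "length ts = Suc r"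
    using set_ts unfolding r_def by (cases ts) auto
  have t_mono: "strict_mono_on {..r} t"
    using ts_sorted len unfolding t_def
    by (auto simp: strict_mono_on_def sorted_wrt_iff_nth_less)
  have t_range: "t ` {..r} = insert 0 (insert 1 J)"
    unfolding set_ts[symmetric] t_def set_conv_nth len by (auto simp: less_Suc_eq_le)
  then have t_T: "t ` {..r} \<subseteq> {0..1}"
    using J by auto
  have t_01: "t i \<in> {0..1}" if "i \<le> r" for i
    using t_T that by blast
  have t_le: "t i \<le> t j" if "i \<le> j" "j \<le> r" for i j
    using strict_mono_onD[OF t_mono, of i j] that by (cases "i = j") auto
  have t0: "t 0 = 0"
  proof -
    obtain i where "i \<le> r" "t i = 0"
      using t_range by (metis atMost_iff image_iff insertI1)
    then show ?thesis
      using t_le[of 0 i] t_01[of 0] by simp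
  qed
  have tr: "t r = 1"
  proof -
    obtain i where "i \<le> r" "t i = 1"
      using t_range by (metis atMost_iff image_iff insertI1 insertI2)
    then show ?thesis
      using t_le[of i r] t_01[of r] by simp
  qed
  have "r > 0"
    using t0 tr by (cases r) auto
  have "\<exists>i\<le>r. t i = x" if "x \<in> J" for x
    using that t_range by (metis atMost_iff image_iff insertI2)
  then obtain idx where idx: "idx x \<le> r" "t (idx x) = x" if "x \<in> J" for x
    by metis
  define H where "H v = f (\<lambda>x\<in>J. real (sum_list (take (idx x) v)))" for v
  define K where "K N i = nat \<lfloor>real N * t i\<rfloor>" for N i
  define V where "V N \<omega> = increments r (\<lambda>i. partial_sum (fst \<omega>) (K N i))"
    for N and \<omega> :: "(nat \<Rightarrow> nat) \<times> (nat \<Rightarrow> nat)"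
  define W where "W \<omega> = increments r (\<lambda>i. X (t i) \<omega>)" for \<omega>
  \<comment> \<open>Lists of the wrong length are never attained, so 0 is the right bound for
    them.\<close>
  define g where "g v N = (if length v = r then
      (\<Prod>i<r. real ((K N (Suc i) - Suc (K N i)) choose (v ! i)) * p N ^ (v ! i)) / U N else 0)" for v N
  have K: "K N 0 = 0" "K N r = N" "mono_on {..r} (K N)" for N
    unfolding K_def by (auto simp: t0 tr mono_on_def intro!: nat_mono floor_mono mult_left_mono t_le)
  have H_V: "f (\<lambda>x\<in>J. real (partial_sum (fst \<omega>) (nat \<lfloor>real N * x\<rfloor>))) = H (V N \<omega>)" for N \<omega>
  proof -
    have "mono_on {..r} (\<lambda>i. partial_sum (fst \<omega>) (K N i))"
      using K(3) by (auto simp: mono_on_def intro: partial_sum_mono)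
    then have "sum_list (take i (V N \<omega>)) = partial_sum (fst \<omega>) (K N i)" if "i \<le> r" for i
      unfolding V_def using that K(1) by (intro sum_list_take_increments) (auto simp: partial_sum_def)
    then have "(\<lambda>x\<in>J. real (partial_sum (fst \<omega>) (nat \<lfloor>real N * x\<rfloor>)))
        = (\<lambda>x\<in>J. real (sum_list (take (idx x) (V N \<omega>))))"
      using idx by (intro restrict_ext) (simp add: K_def)
    then show ?thesis
      by (simp add: H_def)
  qed
  have W_meas: "W \<in> measurable M (count_space UNIV)"
    unfolding W_def using measurable_increments[OF t_T t_mono] .
  \<comment> \<open>Only an almost sure identity, since the Poisson process starts at 0 and is
    nondecreasing only almost surely.\<close>
  have H_W: "AE \<omega> in M. f (\<lambda>x\<in>J. real (X x \<omega>)) = H (W \<omega>)"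
    using starts_at_zero nondecreasing
  proof eventually_elim
    case (elim \<omega>)
    have "mono_on {..r} (\<lambda>i. X (t i) \<omega>)"
    proof (rule mono_onI)
      fix i j assume "i \<in> {..r}" "j \<in> {..r}" "i \<le> j"
      then show "X (t i) \<omega> \<le> X (t j) \<omega>"
        using t_01 t_le[of i j] by (intro mono_onD[OF elim(2)]) auto
    qed
    then have "sum_list (take i (W \<omega>)) = X (t i) \<omega>" if "i \<le> r" for i
      unfolding W_def using that elim(1) t0 by (intro sum_list_take_increments) auto
    then have "(\<lambda>x\<in>J. real (X x \<omega>)) = (\<lambda>x\<in>J. real (sum_list (take (idx x) (W \<omega>))))"
      using idx by (intro restrict_ext) simp
    then show ?case
      by (simp add: H_def)
  qed
  \<comment> \<open>Measurability passes through the list of values on the grid, which lives in a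
    countable discrete space.\<close>
  have X_meas: "(\<lambda>\<omega>. f (\<lambda>x\<in>J. real (X x \<omega>))) \<in> borel_measurable M"
  proof -
    have "(\<lambda>\<omega>. map (\<lambda>i. X (t i) \<omega>) [0..<Suc r]) \<in> measurable M (count_space UNIV)"
      using t_01 by (intro measurable_map_list measurable_process) (simp add: less_Suc_eq_le del: upt_Suc)
    then have "(\<lambda>\<omega>. f (\<lambda>x\<in>J. real (map (\<lambda>i. X (t i) \<omega>) [0..<Suc r] ! idx x))) \<in> borel_measurable M"
      by (rule measurable_compose[where g = "\<lambda>l. f (\<lambda>x\<in>J. real (l ! idx x))"]) simp
    moreover have "(\<lambda>x\<in>J. real (map (\<lambda>i. X (t i) \<omega>) [0..<Suc r] ! idx x)) = (\<lambda>x\<in>J. real (X x \<omega>))" for \<omega>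
      using idx by (intro restrict_ext) (simp add: nth_map less_Suc_eq_le del: upt_Suc)
    ultimately show ?thesis
      by simp
  qed
  have "(\<lambda>N. \<integral>\<omega>. H (V N \<omega>) \<partial>P_Geo N (a N) (c1 N) (c2 N)) \<longlonglongrightarrow> (\<integral>\<omega>. H (W \<omega>) \<partial>M)"
  proof -
    obtain B where B: "\<And>y. y \<in> J \<rightarrow>\<^sub>E UNIV \<Longrightarrow> \<bar>f y\<bar> \<le> B"
      using f unfolding bounded_iff by auto
    show ?thesis
    proof (rule integral_tendsto_of_point_mass_bound[where B = B and g = g])
      show "eventually (\<lambda>N. prob_space (P_Geo N (a N) (c1 N) (c2 N))) sequentially"
        using pos summable by eventually_elim (auto intro: prob_space_P_Geo)
      show "V N \<in> measurable (P_Geo N (a N) (c1 N) (c2 N)) (count_space UNIV)" for N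
        by (rule measurable_P_Geo)
      show "\<bar>H v\<bar> \<le> B" for v
        unfolding H_def by (rule B) auto
      show "prob_space M"
        by unfold_locales
      show "W \<in> measurable M (count_space UNIV)"
        by fact
    next
      fix v :: "nat list"
      show "eventually (\<lambda>N. g v N \<le> measure (P_Geo N (a N) (c1 N) (c2 N))
          (V N -` {v} \<inter> space (P_Geo N (a N) (c1 N) (c2 N)))) sequentially"
        using pos summable pq Z_le weight_ge eventually_ge_at_top[of 1]
      proof eventually_elim
        case (elim N)
        show ?case
        proof (cases "length v = r")
          case True
          show ?thesis
            unfolding g_def V_def using True elim K[of N]
            by (simp, intro prob_P_Geo_increments_ge[where q = "q N"]) auto
        qed (simp add: g_def)
      qed
      show "g v \<longlonglongrightarrow> measure M (W -` {v} \<inter> space M)"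
      proof (cases "length v = r")
        case True
        have "(\<lambda>N. real ((K N (Suc i) - Suc (K N i)) choose (v ! i)) * p N ^ (v ! i))
            \<longlonglongrightarrow> ((t (Suc i) - t i) * lam) ^ (v ! i) / fact (v ! i)" if "i < r" for i
          using that t_01[of i] strict_mono_onD[OF t_mono, of i "Suc i"] unfolding K_def
          by (intro tendsto_choose_times_power p_lim tendsto_floor_block) auto
        then have "(\<lambda>N. (\<Prod>i<r. real ((K N (Suc i) - Suc (K N i)) choose (v ! i)) * p N ^ (v ! i)) / U N)
            \<longlonglongrightarrow> (\<Prod>i<r. ((t (Suc i) - t i) * lam) ^ (v ! i) / fact (v ! i)) / exp lam"
          by (intro tendsto_divide tendsto_prod U_lim) auto
        also have "(\<Prod>i<r. ((t (Suc i) - t i) * lam) ^ (v ! i) / fact (v ! i)) / exp lam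
            = (\<Prod>i<r. ((t (Suc i) - t i) * lam) ^ (v ! i) / fact (v ! i) * exp (- (lam * (t (Suc i) - t i))))"
        proof -
          \<comment> \<open>The factor \<open>1 / exp lam\<close> coming from \<open>U\<close> is
            distributed over the blocks in proportion to their lengths, one Poisson normalisation
            each.\<close>
          have "(\<Sum>i<r. t (Suc i) - t i) = 1"
            by (simp add: sum_lessThan_telescope t0 tr)
          then have "(\<Prod>i<r. exp (- (lam * (t (Suc i) - t i)))) = exp (- lam)"
            by (simp add: sum_negf sum_distrib_left[symmetric] flip: exp_sum)
          then show ?thesis
            by (simp only: prod.distrib) (simp add: exp_minus divide_inverse)
        qed
        also have "\<dots> = (\<Prod>i<r. pmf (poisson_pmf (lam * (t (Suc i) - t i))) (v ! i))"
        proof (rule prod.cong)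
          fix i assume "i \<in> {..<r}"
          then have "0 < lam * (t (Suc i) - t i)"
            using strict_mono_onD[OF t_mono, of i "Suc i"] \<open>lam > 0\<close> by simp
          then show "((t (Suc i) - t i) * lam) ^ (v ! i) / fact (v ! i) * exp (- (lam * (t (Suc i) - t i)))
              = pmf (poisson_pmf (lam * (t (Suc i) - t i))) (v ! i)"
            by (simp add: mult.commute)
        qed simp
        also have "\<dots> = measure M (W -` {v} \<inter> space M)"
          unfolding W_def using prob_increments[OF t_T t_mono \<open>r > 0\<close> True] by simp
        finally show ?thesis
          using True by (simp add: g_def[abs_def])
      next
        case False
        then have "W -` {v} \<inter> space M = {}"
          by (auto simp: W_def)
        with False show ?thesis
          by (simp add: g_def[abs_def])
      qed
    qed
  qed
  also have "(\<integral>\<omega>. H (W \<omega>) \<partial>M) = (\<integral>\<omega>. f (\<lambda>x\<in>J. real (X x \<omega>)) \<partial>M)"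
    using H_W X_meas measurable_compose[OF W_meas, of H borel]
    by (intro integral_cong_AE) (auto simp: eq_commute)
  finally show "(\<lambda>N. \<integral>\<omega>. f (\<lambda>x\<in>J. real (partial_sum (fst \<omega>) (nat \<lfloor>real N * x\<rfloor>))) \<partial>P_Geo N (a N) (c1 N) (c2 N))
      \<longlonglongrightarrow> (\<integral>\<omega>. f (\<lambda>x\<in>J. real (X x \<omega>)) \<partial>M)"
    by (simp only: H_V)
qed

section \<open>The two parameter regimes\<close>

text \<open>Here \<open>a * c1\<close> tends to 1, hence the ratio \<open>s\<close> of the candidate
  terms tends to 0 and index \<open>N\<close> dominates. The corrections in \<open>U\<close> tend to
  1, and \<open>exp lam\<close> comes from \<open>(1 - a / c1) ^ N\<close> with
  \<open>N * (a / c1)\<close> tending to \<open>lam\<close>.\<close>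

lemma fdd_converges_large_c1:
  fixes lam \<gamma> :: real and a c1 c2 :: "nat \<Rightarrow> real" and M :: "'w measure" and X :: "real \<Rightarrow> 'w \<Rightarrow> nat"
  assumes "lam > 0" "\<gamma> > 0"
    and par: "\<And>N. N \<ge> 1 \<Longrightarrow> c1 N = sqrt (real N / lam) \<and> a N = sqrt (lam / (real N + 1)) \<and> c2 N = \<gamma>"
    and poisson: "poisson_process M {0..1} lam X"
  shows "fdd_converges (\<lambda>N. P_Geo N (a N) (c1 N) (c2 N))
    (\<lambda>N x \<omega>. real (partial_sum (fst \<omega>) (nat \<lfloor>real N * x\<rfloor>))) M (\<lambda>x \<omega>. real (X x \<omega>)) {0..1}"
proof -
  define s where "s N = (1 - a N * c1 N) / ((1 - a N / c2 N) * (1 - a N * c2 N))" for N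
  define U where "U N = (1 / (1 - a N / c1 N)) ^ N * (1 / (1 - a N * c2 N)) * (1 / (1 - s N))" for N
  have N1: "eventually (\<lambda>N::nat. N \<ge> 1) sequentially"
    by (rule eventually_ge_at_top)
  have par': "eventually (\<lambda>N. c1 N = sqrt (real N / lam) \<and> a N = sqrt (lam / (real N + 1)) \<and> c2 N = \<gamma>) sequentially"
    using N1 by eventually_elim (rule par)
  have pos: "eventually (\<lambda>N. a N > 0 \<and> c1 N > 0 \<and> c2 N > 0) sequentially"
    using N1 par' by eventually_elim (use assms in auto)
  have prod_eq: "eventually (\<lambda>N. a N * c1 N = sqrt (real N / (real N + 1))) sequentially"
    using N1 par' by eventually_elim (use \<open>lam > 0\<close> in \<open>simp flip: real_sqrt_mult\<close>)
  have quot_eq: "eventually (\<lambda>N. a N / c1 N = lam / sqrt (real N * (real N + 1))) sequentially"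
    using N1 par'
  proof eventually_elim
    case (elim N)
    then have "a N / c1 N = sqrt (lam\<^sup>2 / (real N * (real N + 1)))"
      using \<open>lam > 0\<close> by (simp add: power2_eq_square mult.commute flip: real_sqrt_divide)
    then show ?case
      using \<open>lam > 0\<close> by (simp add: real_sqrt_divide)
  qed
  have prod: "eventually (\<lambda>N. a N * c1 N < 1) sequentially"
    using prod_eq by eventually_elim simp
  have lims: "(\<lambda>N. sqrt (lam / (real N + 1))) \<longlonglongrightarrow> 0"
    "(\<lambda>N. sqrt (real N / (real N + 1))) \<longlonglongrightarrow> 1"
    "(\<lambda>N. real N * (lam / sqrt (real N * (real N + 1)))) \<longlonglongrightarrow> lam"
    "filterlim (\<lambda>N. sqrt (real N / lam) * \<gamma>) at_top sequentially"
    using \<open>lam > 0\<close> \<open>\<gamma> > 0\<close> by real_asymp+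
  have a_lim: "a \<longlonglongrightarrow> 0"
    using lims(1) by (rule Lim_transform_eventually) (use par' in eventually_elim, simp)
  have ac1_lim: "(\<lambda>N. a N * c1 N) \<longlonglongrightarrow> 1"
    using lims(2) by (rule Lim_transform_eventually) (use prod_eq in eventually_elim, simp)
  have p_lim: "(\<lambda>N. real N * (a N / c1 N)) \<longlonglongrightarrow> lam"
    using lims(3) by (rule Lim_transform_eventually) (use quot_eq in eventually_elim, simp)
  have "eventually (\<lambda>N. sqrt (real N / lam) * \<gamma> \<ge> 1) sequentially"
    using lims(4) by (simp add: filterlim_at_top)
  then have ge1: "eventually (\<lambda>N. c1 N * c2 N \<ge> 1) sequentially"
    using par' by eventually_elim simp
  have c2_lim: "c2 \<longlonglongrightarrow> \<gamma>"
    using par' by (intro tendsto_eventually) (auto elim: eventually_mono)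
  have ac2_lim: "(\<lambda>N. a N * c2 N) \<longlonglongrightarrow> 0" and a_c2_lim: "(\<lambda>N. a N / c2 N) \<longlonglongrightarrow> 0"
    using tendsto_mult[OF a_lim c2_lim] tendsto_divide[OF a_lim c2_lim] \<open>\<gamma> > 0\<close> by simp_all
  have a_c1_lim: "(\<lambda>N. a N / c1 N) \<longlonglongrightarrow> 0"
    using p_lim by (rule tendsto_zero_of_times_nat)
  have "s \<longlonglongrightarrow> (1 - 1) / ((1 - 0) * (1 - 0))"
    unfolding s_def[abs_def] by (intro tendsto_intros ac1_lim ac2_lim a_c2_lim) auto
  then have s_lim: "s \<longlonglongrightarrow> 0"
    by simp
  have lt: "eventually (\<lambda>N. a N * c2 N < 1) sequentially" "eventually (\<lambda>N. a N / c1 N < 1) sequentially"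
    "eventually (\<lambda>N. a N / c2 N < 1) sequentially" "eventually (\<lambda>N. s N < 1) sequentially"
    using ac2_lim a_c1_lim a_c2_lim s_lim by (auto elim: order_tendstoD)
  show ?thesis
  proof (rule fdd_converges_of_weight_bounds[where p = "\<lambda>N. a N / c1 N" and q = "\<lambda>N. a N * c1 N" and U = U])
    show "eventually (\<lambda>N. (\<lambda>(m, n). weight N (a N) (c1 N) (c2 N) (partial_sum m) (partial_sum n))
      summable_on step_pairs N) sequentially"
      using N1 pos prod lt
      by eventually_elim (rule partition_fun_bound_last_term(1); simp add: s_def)
    show "eventually (\<lambda>N. 0 \<le> a N / c1 N \<and> 0 \<le> a N * c1 N \<and> a N * c1 N < 1) sequentially"
      using pos prod by eventually_elim auto
    show "eventually (\<lambda>N. partition_fun N (a N) (c1 N) (c2 N) \<le> (1 / (1 - a N * c1 N)) ^ N * U N) sequentially"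
      using N1 pos prod lt unfolding U_def s_def
      by eventually_elim (rule partition_fun_bound_last_term(2); simp)
    show "eventually (\<lambda>N. \<forall>m n. m N = 0 \<longrightarrow> (a N / c1 N) ^ partial_sum m N * (a N * c1 N) ^ partial_sum n N
      \<le> weight N (a N) (c1 N) (c2 N) (partial_sum m) (partial_sum n)) sequentially"
      using N1 pos ge1
    proof eventually_elim
      case (elim N)
      show ?case
      proof (intro allI impI)
        fix m n :: "nat \<Rightarrow> nat" assume "m N = 0"
        \<comment> \<open>As the last step vanishes, the split of the first path at
          \<open>N - 1\<close> does no harm: the term of index \<open>N\<close> is exactly the
          required product.\<close>
        then have "partial_sum m N = partial_sum m (N - 1)"
          using elim partial_sum_diff[of "N - 1" N m] by (cases N) (auto simp: partial_sum_def)
        then have "(a N / c1 N) ^ partial_sum m N * (a N * c1 N) ^ partial_sum n N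
            = max_term N (a N) (c1 N) (c2 N) N (partial_sum m) (partial_sum n)"
          using elim by (simp add: max_term_eq)
        also have "\<dots> \<le> weight N (a N) (c1 N) (c2 N) (partial_sum m) (partial_sum n)"
          using elim by (intro max_term_le_weight) auto
        finally show "(a N / c1 N) ^ partial_sum m N * (a N * c1 N) ^ partial_sum n N
            \<le> weight N (a N) (c1 N) (c2 N) (partial_sum m) (partial_sum n)" .
      qed
    qed
    have "(\<lambda>N. (1 - a N / c1 N) ^ N) \<longlonglongrightarrow> exp (- lam)"
      using p_lim by (rule tendsto_power_exp) (use pos in \<open>auto elim: eventually_mono\<close>)
    then have "(\<lambda>N. 1 / (1 - a N / c1 N) ^ N * (1 / (1 - a N * c2 N)) * (1 / (1 - s N)))
        \<longlonglongrightarrow> 1 / exp (- lam) * (1 / (1 - 0)) * (1 / (1 - 0))"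
      by (intro tendsto_intros ac2_lim s_lim) auto
    then show "U \<longlonglongrightarrow> exp lam"
      unfolding U_def[abs_def] by (simp add: power_one_over exp_minus inverse_eq_divide)
  qed (fact poisson pos p_lim \<open>lam > 0\<close>)+
qed

text \<open>Here \<open>N * (a * c2)\<close> tends to \<open>lam\<close>, while
  \<open>N * (a * c1)\<close> tends to 0. The null second path alone thus carries enough mass, and
  \<open>U\<close> tends to \<open>exp lam * 1\<close>.\<close>

lemma fdd_converges_large_c2:
  fixes lam \<gamma> \<theta> :: real and a c1 c2 :: "nat \<Rightarrow> real" and M :: "'w measure" and X :: "real \<Rightarrow> 'w \<Rightarrow> nat"
  assumes "lam > 0" "\<gamma> > 0" "\<theta> > 0"
    and par: "\<And>N. N \<ge> 1 \<Longrightarrow> c1 N = \<gamma> \<and> a N = 1 / real N powr (\<theta> + 1) \<and> c2 N = lam * real N powr \<theta>"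
    and poisson: "poisson_process M {0..1} lam X"
  shows "fdd_converges (\<lambda>N. P_Geo N (a N) (c1 N) (c2 N))
    (\<lambda>N x \<omega>. real (partial_sum (fst \<omega>) (nat \<lfloor>real N * x\<rfloor>))) M (\<lambda>x \<omega>. real (X x \<omega>)) {0..1}"
proof -
  define U where "U N = (1 / (1 - a N * c2 N)) ^ N * (1 / (1 - a N * c1 N)) ^ N" for N
  have N1: "eventually (\<lambda>N::nat. N \<ge> 1) sequentially"
    by (rule eventually_ge_at_top)
  have par': "eventually (\<lambda>N. c1 N = \<gamma> \<and> a N = 1 / real N powr (\<theta> + 1) \<and> c2 N = lam * real N powr \<theta>) sequentially"
    using N1 by eventually_elim (rule par)
  have pos: "eventually (\<lambda>N. a N > 0 \<and> c1 N > 0 \<and> c2 N > 0) sequentially"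
    using N1 par' by eventually_elim (use assms in auto)
  have "(\<lambda>N. real N * (1 / real N powr (\<theta> + 1) * \<gamma>)) \<longlonglongrightarrow> 0"
    "(\<lambda>N. real N * (1 / real N powr (\<theta> + 1) * (lam * real N powr \<theta>))) \<longlonglongrightarrow> lam"
    "filterlim (\<lambda>N. \<gamma> * (lam * real N powr \<theta>)) at_top sequentially"
    using \<open>lam > 0\<close> \<open>\<gamma> > 0\<close> \<open>\<theta> > 0\<close> by real_asymp+
  then have q_lim: "(\<lambda>N. real N * (a N * c1 N)) \<longlonglongrightarrow> 0"
    and p_lim: "(\<lambda>N. real N * (a N * c2 N)) \<longlonglongrightarrow> lam"
    and c1c2: "filterlim (\<lambda>N. c1 N * c2 N) at_top sequentially"
    by (subst filterlim_cong[OF refl refl]; use par' in \<open>auto elim: eventually_mono\<close>)+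
  have lt: "eventually (\<lambda>N. a N * c1 N < 1) sequentially" "eventually (\<lambda>N. a N * c2 N < 1) sequentially"
    using tendsto_zero_of_times_nat[OF q_lim] tendsto_zero_of_times_nat[OF p_lim]
    by (auto elim: order_tendstoD)
  have ge1: "eventually (\<lambda>N. c1 N * c2 N \<ge> 1) sequentially"
    using c1c2 by (simp add: filterlim_at_top)
  show ?thesis
  proof (rule fdd_converges_of_weight_bounds[where p = "\<lambda>N. a N * c2 N" and q = "\<lambda>_. 0" and U = U])
    show "eventually (\<lambda>N. (\<lambda>(m, n). weight N (a N) (c1 N) (c2 N) (partial_sum m) (partial_sum n))
      summable_on step_pairs N) sequentially"
      using N1 pos lt ge1 by eventually_elim (rule partition_fun_bound_product(1); simp)
    show "eventually (\<lambda>N. 0 \<le> a N * c2 N \<and> 0 \<le> (0::real) \<and> (0::real) < 1) sequentially"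
      using pos by eventually_elim auto
    show "eventually (\<lambda>N. partition_fun N (a N) (c1 N) (c2 N) \<le> (1 / (1 - 0)) ^ N * U N) sequentially"
      using N1 pos lt ge1
    proof eventually_elim
      case (elim N)
      then show ?case
        using partition_fun_bound_product(2)[of N "a N" "c1 N" "c2 N"] by (simp add: U_def)
    qed
    show "eventually (\<lambda>N. \<forall>m n. m N = 0 \<longrightarrow> (a N * c2 N) ^ partial_sum m N * 0 ^ partial_sum n N
      \<le> weight N (a N) (c1 N) (c2 N) (partial_sum m) (partial_sum n)) sequentially"
      using N1 pos ge1
    proof eventually_elim
      case (elim N)
      show ?case
      proof (intro allI impI)
        fix m n :: "nat \<Rightarrow> nat"
        show "(a N * c2 N) ^ partial_sum m N * 0 ^ partial_sum n N
            \<le> weight N (a N) (c1 N) (c2 N) (partial_sum m) (partial_sum n)"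
        proof (cases "partial_sum n N = 0")
          case True
          then have "partial_sum n 1 = 0"
            using partial_sum_mono[of 1 N n] elim by simp
          \<comment> \<open>Index 1 is the right candidate: \<open>L1 0 = 0\<close>, so every step
            of the first path has weight \<open>a * c2\<close>.\<close>
          with True have "(a N * c2 N) ^ partial_sum m N * 0 ^ partial_sum n N
              = max_term N (a N) (c1 N) (c2 N) 1 (partial_sum m) (partial_sum n)"
            using elim by (subst max_term_eq) (auto simp: partial_sum_def)
          also have "\<dots> \<le> weight N (a N) (c1 N) (c2 N) (partial_sum m) (partial_sum n)"
            using elim by (intro max_term_le_weight) auto
          finally show ?thesis .
        next
          case False
          then show ?thesis
            using elim weight_nonneg[of "a N" "c1 N" "c2 N"] by (simp add: zero_power)
        qed
      qed
    qed
    have "(\<lambda>N. (1 - a N * c2 N) ^ N) \<longlonglongrightarrow> exp (- lam)" "(\<lambda>N. (1 - a N * c1 N) ^ N) \<longlonglongrightarrow> exp (- 0)"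
      using pos by (intro tendsto_power_exp p_lim q_lim; force elim: eventually_mono)+
    then have "(\<lambda>N. 1 / (1 - a N * c2 N) ^ N * (1 / (1 - a N * c1 N) ^ N))
        \<longlonglongrightarrow> 1 / exp (- lam) * (1 / exp (- 0))"
      by (intro tendsto_intros) auto
    then show "U \<longlonglongrightarrow> exp lam"
      unfolding U_def[abs_def] by (simp add: power_one_over exp_minus inverse_eq_divide)
  qed (fact poisson pos p_lim \<open>lam > 0\<close>)+
qed

theorem theorem1p5:
  fixes lam :: real and a c1 c2 :: "nat \<Rightarrow> real"
    and M :: "'w measure" and X :: "real \<Rightarrow> 'w \<Rightarrow> nat"
  assumes lam_pos: "lam > 0"
    and parameters:
      "(\<exists>\<gamma>>0. \<forall>N\<ge>1. c1 N = sqrt (real N / lam) \<and> a N = sqrt (lam / (real N + 1)) \<and> c2 N = \<gamma>) \<or>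
       (\<exists>\<gamma>>0. \<exists>\<theta>>0. \<forall>N\<ge>1. c1 N = \<gamma> \<and> a N = 1 / real N powr (\<theta> + 1) \<and> c2 N = lam * real N powr \<theta>)"
    and poisson: "poisson_process M {0..1} lam X"
  shows "fdd_converges
           (\<lambda>N. P_Geo N (a N) (c1 N) (c2 N))
           (\<lambda>N x \<omega>. real (partial_sum (fst \<omega>) (nat \<lfloor>real N * x\<rfloor>)))
           M (\<lambda>x \<omega>. real (X x \<omega>)) {0..1}"
  using parameters
proof (elim disjE exE conjE)
  fix \<gamma> :: real
  assume "\<gamma> > 0"
    "\<forall>N\<ge>1. c1 N = sqrt (real N / lam) \<and> a N = sqrt (lam / (real N + 1)) \<and> c2 N = \<gamma>"
  then show ?thesis
    using lam_pos poisson by (intro fdd_converges_large_c1) auto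
next
  fix \<gamma> \<theta> :: real
  assume "\<gamma> > 0" "\<theta> > 0"
    "\<forall>N\<ge>1. c1 N = \<gamma> \<and> a N = 1 / real N powr (\<theta> + 1) \<and> c2 N = lam * real N powr \<theta>"
  then show ?thesis
    using lam_pos poisson by (intro fdd_converges_large_c2) auto
qed

end
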